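(* Let $G$ be a countable group and let $\mathcal{N}$ be a non-empty filtering family of finite index normal subgroups of $G$. For a URS $\mathcal{H}$ of $G$, the following are equivalent: (1) $\mathcal{H}$ is closed for the topology $\tau_{\mathcal{N}}$, i.e. $\mathrm{cl}_{\mathcal{N}}(\mathcal{H})=\mathcal{H}$. (2) There exists a pro-$\mathcal{N}$ compact minimal $G$-space $X$ such that $S_G(X)=\mathcal{H}$.
   Context: $\mathrm{Sub}(G)$ is the set of subgroups of $G$ with the topology induced from the product topology on $\{0,1\}^G$; it is compact and $G$ acts on it by conjugation. A URS of $G$ is a non-empty closed $G$-invariant minimal subset of $\mathrm{Sub}(G)$. A family $\mathcal{N}$ of normal subgroups is filtering if for all $N_1,N_2\in\mathcal{N}$ there is $N_3\in\mathcal{N}$ with $N_3\leq N_1\cap N_2$; then the cosets $gN$ ($g\in G$, $N\in\mathcal{N}$) form a basis of a group topology $\tau_{\mathcal{N}}$ on $G$, and $\mathrm{cl}_{\mathcal{N}}(H)=\bigcap_{N\in\mathcal{N}}HN$ is the $\tau_{\mathcal{N}}$-closure of a subgroup $H$. When $\mathcal{N}$ consists of finite index subgroups, for every URS $\mathcal{H}$ the set $\overline{\{\mathrm{cl}_{\mathcal{N}}(H):H\in\mathcal{H}\}}\subseteq \mathrm{Sub}(G)$ contains a unique URS, denoted $\mathrm{cl}_{\mathcal{N}}(\mathcal{H})$. Compact spaces are Hausdorff. A $G$-space is a non-empty space with an action of (the discrete group) $G$ by homeomorphisms; it is minimal if all orbits are dense. If $X$ is a minimal compact $G$-space, the closure $\overline{\{G_x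 : x\in X\}}$ in $\mathrm{Sub}(G)$ of the set of point stabilizers contains a unique URS, denoted $S_G(X)$ (the stabilizer URS of $X$). A compact $G$-space $X$ is pro-$\mathcal{N}$ if the action map $G\times X\to X$ is continuous when $G$ is equipped with the topology $\tau_{\mathcal{N}}$. *)

theory Defs
  imports "HOL-Analysis.Analysis" "HOL-Algebra.Group_Action"
begin

text \<open>Subgroups are identified with their indicator functions on the carrier.\<close>

definition Sub_top :: "('g, 'm) monoid_scheme \<Rightarrow> 'g set topology"
  where "Sub_top G =
    pullback_topology {H. subgroup H G} (\<lambda>H. \<lambda>g\<in>carrier G. g \<in> H)
      (product_topology (\<lambda>_. discrete_topology (UNIV :: bool set)) (carrier G))"

definition conj_act :: "('g, 'm) monoid_scheme \<Rightarrow> 'g \<Rightarrow> 'g set \<Rightarrow> 'g set"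
  where "conj_act G g = (\<lambda>H\<in>{H. subgroup H G}. g <#\<^bsub>G\<^esub> H #>\<^bsub>G\<^esub> inv\<^bsub>G\<^esub> g)"

definition orbits_dense :: "('g, 'm) monoid_scheme \<Rightarrow> 'x topology \<Rightarrow> ('g \<Rightarrow> 'x \<Rightarrow> 'x) \<Rightarrow> bool"
  where "orbits_dense G X \<phi> \<longleftrightarrow> (\<forall>x\<in>topspace X. X closure_of orbit G \<phi> x = topspace X)"

definition is_URS :: "('g, 'm) monoid_scheme \<Rightarrow> 'g set set \<Rightarrow> bool"
  where "is_URS G \<H> \<longleftrightarrow>
    \<H> \<noteq> {} \<and> closedin (Sub_top G) \<H> \<and>
    (\<forall>g\<in>carrier G. conj_act G g ` \<H> \<subseteq> \<H>) \<and>
    orbits_dense G (subtopology (Sub_top G) \<H>) (conj_act G)"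

definition filtering :: "'g set set \<Rightarrow> bool"
  where "filtering \<N> \<longleftrightarrow> (\<forall>N1\<in>\<N>. \<forall>N2\<in>\<N>. \<exists>N3\<in>\<N>. N3 \<subseteq> N1 \<inter> N2)"

text \<open>For a non-empty filtering family of normal subgroups, the generating cosets are a basis.\<close>

definition coset_topology :: "('g, 'm) monoid_scheme \<Rightarrow> 'g set set \<Rightarrow> 'g topology"
  where "coset_topology G \<N> = topology_generated_by {g <#\<^bsub>G\<^esub> N | g N. g \<in> carrier G \<and> N \<in> \<N>}"

definition cl_subgroup :: "('g, 'm) monoid_scheme \<Rightarrow> 'g set set \<Rightarrow> 'g set \<Rightarrow> 'g set"
  where "cl_subgroup G \<N> H = (\<Inter>N\<in>\<N>. H <#>\<^bsub>G\<^esub> N)"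

definition cl_URS :: "('g, 'm) monoid_scheme \<Rightarrow> 'g set set \<Rightarrow> 'g set set \<Rightarrow> 'g set set"
  where "cl_URS G \<N> \<H> =
    (THE \<K>. is_URS G \<K> \<and> \<K> \<subseteq> Sub_top G closure_of (cl_subgroup G \<N> ` \<H>))"

definition G_space :: "('g, 'm) monoid_scheme \<Rightarrow> 'x topology \<Rightarrow> ('g \<Rightarrow> 'x \<Rightarrow> 'x) \<Rightarrow> bool"
  where "G_space G X \<phi> \<longleftrightarrow>
    topspace X \<noteq> {} \<and> group_action G (topspace X) \<phi> \<and>
    (\<forall>g\<in>carrier G. homeomorphic_map X X (\<phi> g))"

definition compact_G_space :: "('g, 'm) monoid_scheme \<Rightarrow> 'x topology \<Rightarrow> ('g \<Rightarrow> 'x \<Rightarrow> 'x) \<Rightarrow> bool"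
  where "compact_G_space G X \<phi> \<longleftrightarrow> G_space G X \<phi> \<and> compact_space X \<and> Hausdorff_space X"

definition minimal_G_space :: "('g, 'm) monoid_scheme \<Rightarrow> 'x topology \<Rightarrow> ('g \<Rightarrow> 'x \<Rightarrow> 'x) \<Rightarrow> bool"
  where "minimal_G_space G X \<phi> \<longleftrightarrow> G_space G X \<phi> \<and> orbits_dense G X \<phi>"

definition pro_G_space ::
    "('g, 'm) monoid_scheme \<Rightarrow> 'g set set \<Rightarrow> 'x topology \<Rightarrow> ('g \<Rightarrow> 'x \<Rightarrow> 'x) \<Rightarrow> bool"
  where "pro_G_space G \<N> X \<phi> \<longleftrightarrow>
    compact_G_space G X \<phi> \<and>
    continuous_map (prod_topology (coset_topology G \<N>) X) X (\<lambda>(g, x). \<phi> g x)"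

definition stabilizer_URS ::
    "('g, 'm) monoid_scheme \<Rightarrow> 'x topology \<Rightarrow> ('g \<Rightarrow> 'x \<Rightarrow> 'x) \<Rightarrow> 'g set set"
  where "stabilizer_URS G X \<phi> =
    (THE \<K>. is_URS G \<K> \<and> \<K> \<subseteq> Sub_top G closure_of (stabilizer G \<phi> ` topspace X))"

end

theory Submission
  imports Defs "HOL-Algebra.Zassenhaus"
begin

text \<open>
Both \<open>cl\<^sub>\<N>(\<H>)\<close> and \<open>S\<^sub>G(X)\<close> arise in the same way. Let \<open>f\<close> be an equivariant, upper semicontinuous map from a
minimal compact \<open>G\<close>-space to the space of subgroups, where \<open>G\<close> is countable. By Baire's theorem \<open>f\<close> has a
continuity point \<open>x\<close>, and every non-empty closed invariant subset of the closure of the image of \<open>f\<close> contains \<open>f x\<close>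
(\<open>value_at_continuity_point_mem\<close>). So that closure contains exactly one URS, the orbit closure of \<open>f x\<close>.
Consequently the URS of \<open>f\<close> contains some value of \<open>f\<close> (\<open>ex_value_in_image_URS\<close>), and conversely a URS that
contains some value of \<open>f\<close>, at whatever point, is the URS of \<open>f\<close> (\<open>image_URS_eq\<close>).

The stabilizer map of a minimal compact space is of this kind. So is \<open>H \<mapsto> cl\<^sub>\<N>(H)\<close> on a URS \<open>\<H>\<close>, because for \<open>N\<close>
of finite index minimality makes \<open>H \<mapsto> HN\<close> locally constant on \<open>\<H>\<close> (\<open>closedin_mem_set_mult_normal\<close>).

It remains to compare values. The URS \<open>\<H>\<close> is fixed by \<open>cl\<^sub>\<N>\<close> if and only if it contains a subgroup that is closed
in \<open>\<tau>\<^sub>\<N>\<close>, and it is the stabilizer URS of \<open>X\<close> if and only if it contains a point stabilizer of \<open>X\<close>. Point stabilizers of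
a pro-\<open>\<N>\<close> space are closed (\<open>cl_subgroup_stabilizer\<close>), and a closed subgroup \<open>H\<close> is a point stabilizer in a minimal
pro-\<open>\<N>\<close> space, namely the inverse limit of the finite \<open>G\<close>-sets \<open>G/HN\<close> (\<open>closed_subgroup_is_stabilizer\<close>).
\<close>

section \<open>The power set of a set as a compact space\<close>

text \<open>This is \<open>2\<^sup>A\<close> with subsets in place of indicator functions, in the form in which \<^const>\<open>Sub_top\<close> is
defined. It serves twice: for the subgroups of \<open>G\<close>, and for the space constructed from a closed subgroup.\<close>

definition powerset_top :: "'a set \<Rightarrow> 'a set topology"
  where "powerset_top A = pullback_topology (Pow A) (\<lambda>S. \<lambda>a\<in>A. a \<in> S)
    (product_topology (\<lambda>_. discrete_topology (UNIV :: bool set)) A)"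

lemma topspace_powerset_top [simp]: "topspace (powerset_top A) = Pow A"
  by (auto simp: powerset_top_def topspace_pullback_topology)

lemma clopen_member:
  assumes "a \<in> A"
  shows "openin (powerset_top A) {S \<in> Pow A. a \<in> S \<longleftrightarrow> b}"
proof -
  let ?U = "{p \<in> topspace (product_topology (\<lambda>_. discrete_topology (UNIV :: bool set)) A). p a \<in> {b}}"
  have "openin (product_topology (\<lambda>_. discrete_topology (UNIV :: bool set)) A) ?U"
    by (rule openin_continuous_map_preimage[OF continuous_map_product_projection[OF assms]]) auto
  moreover have "{S \<in> Pow A. a \<in> S \<longleftrightarrow> b} = (\<lambda>S. \<lambda>a\<in>A. a \<in> S) -` ?U \<inter> Pow A"
    using assms by auto
  ultimately show ?thesis
    unfolding powerset_top_def openin_pullback_topology by blast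
qed

lemma continuous_map_powerset_top:
  assumes "f \<in> topspace X \<rightarrow> Pow A"
    and "\<And>a b. a \<in> A \<Longrightarrow> openin X {x \<in> topspace X. a \<in> f x \<longleftrightarrow> b}"
  shows "continuous_map X (powerset_top A) f"
  unfolding powerset_top_def
proof (rule continuous_map_pullback')
  show "continuous_map X (product_topology (\<lambda>_. discrete_topology UNIV) A)
          ((\<lambda>S. \<lambda>a\<in>A. a \<in> S) \<circ> f)"
    unfolding continuous_map_componentwise
  proof (intro conjI ballI)
    show "((\<lambda>S. \<lambda>a\<in>A. a \<in> S) \<circ> f) ` topspace X \<subseteq> extensional A"
      by auto
    fix a assume a: "a \<in> A"
    show "continuous_map X (discrete_topology UNIV) (\<lambda>x. ((\<lambda>S. \<lambda>a\<in>A. a \<in> S) \<circ> f) x a)"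
      unfolding continuous_map_def
    proof (intro conjI allI impI)
      fix U :: "bool set"
      have "{x \<in> topspace X. ((\<lambda>S. \<lambda>a\<in>A. a \<in> S) \<circ> f) x a \<in> U}
          = (\<Union>b\<in>U. {x \<in> topspace X. a \<in> f x \<longleftrightarrow> b})"
        using a by auto
      then show "openin X {x \<in> topspace X. ((\<lambda>S. \<lambda>a\<in>A. a \<in> S) \<circ> f) x a \<in> U}"
        using assms(2)[OF a] by (auto intro!: openin_Union)
    qed auto
  qed
  show "topspace X \<subseteq> f -` Pow A"
    using assms(1) by auto
qed

lemma homeomorphic_maps_powerset_top:
  "homeomorphic_maps (powerset_top A) (product_topology (\<lambda>_. discrete_topology (UNIV :: bool set)) A)
     (\<lambda>S. \<lambda>a\<in>A. a \<in> S) (\<lambda>p. {a \<in> A. p a})"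
  unfolding homeomorphic_maps_def
proof (intro conjI ballI)
  show "continuous_map (powerset_top A) (product_topology (\<lambda>_. discrete_topology (UNIV :: bool set)) A)
     (\<lambda>S. \<lambda>a\<in>A. a \<in> S)"
    unfolding powerset_top_def
    using continuous_map_pullback[where A = "Pow A" and f = "\<lambda>S. \<lambda>a\<in>A. a \<in> S", OF continuous_map_id]
    by simp
  show "continuous_map (product_topology (\<lambda>_. discrete_topology (UNIV :: bool set)) A)
     (powerset_top A) (\<lambda>p. {a \<in> A. p a})"
  proof (rule continuous_map_powerset_top)
    fix a b assume "a \<in> A"
    then show "openin (product_topology (\<lambda>_. discrete_topology (UNIV :: bool set)) A)
       {x \<in> topspace (product_topology (\<lambda>_. discrete_topology UNIV) A). a \<in> {a \<in> A. x a} \<longleftrightarrow> b}"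
      using openin_continuous_map_preimage[OF continuous_map_product_projection[OF \<open>a \<in> A\<close>],
          of "\<lambda>_. discrete_topology (UNIV :: bool set)" "{b}"] by simp
  qed auto
next
  fix p assume "p \<in> topspace (product_topology (\<lambda>_. discrete_topology (UNIV :: bool set)) A)"
  then show "(\<lambda>a\<in>A. a \<in> {a \<in> A. p a}) = p"
    by (auto simp: PiE_iff intro: extensionalityI[of _ A])
qed auto

lemma compact_Hausdorff_powerset_top:
  "compact_space (powerset_top A)" "Hausdorff_space (powerset_top A)"
proof -
  have h: "powerset_top A homeomorphic_space product_topology (\<lambda>_. discrete_topology (UNIV :: bool set)) A"
    using homeomorphic_maps_powerset_top homeomorphic_space_def by blast
  show "compact_space (powerset_top A)"
    unfolding homeomorphic_compact_space[OF h]
    by (simp add: compact_space_product_topology compact_space_discrete_topology)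
  show "Hausdorff_space (powerset_top A)"
    unfolding homeomorphic_Hausdorff_space[OF h]
    by (simp add: Hausdorff_space_product_topology)
qed

lemma openin_cylinder:
  assumes "finite F" "F \<subseteq> A"
  shows "openin (powerset_top A) {S \<in> Pow A. S \<inter> F = T \<inter> F}"
proof -
  have "{S \<in> Pow A. S \<inter> F = T \<inter> F} =
      \<Inter> (insert (Pow A) ((\<lambda>a. {S \<in> Pow A. a \<in> S \<longleftrightarrow> a \<in> T}) ` F))"
    by auto
  moreover have "openin (powerset_top A) \<dots>"
    using assms openin_topspace[of "powerset_top A"]
    by (intro openin_Inter) (auto simp flip: Pow_iff intro!: clopen_member)
  ultimately show ?thesis by simp
qed

lemma openin_powerset_top_cylinder:
  assumes "openin (powerset_top A) U" "S \<in> U"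
  obtains F where "finite F" "F \<subseteq> A" "{T \<in> Pow A. T \<inter> F = S \<inter> F} \<subseteq> U"
proof -
  let ?P = "product_topology (\<lambda>_. discrete_topology (UNIV :: bool set)) A"
  let ?\<chi> = "\<lambda>S. \<lambda>a\<in>A. a \<in> S"
  obtain W where W: "openin ?P W" "U = ?\<chi> -` W \<inter> Pow A"
    using assms(1) unfolding powerset_top_def openin_pullback_topology by blast
  have "?\<chi> S \<in> W"
    using assms(2) unfolding W(2) by simp
  then obtain V where V: "finite {a \<in> A. V a \<noteq> topspace (discrete_topology (UNIV :: bool set))}"
      "?\<chi> S \<in> Pi\<^sub>E A V" "Pi\<^sub>E A V \<subseteq> W"
    using W(1)[unfolded openin_product_topology_alt] by meson
  define F where "F = {a \<in> A. V a \<noteq> UNIV}"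
  have "T \<in> U" if T: "T \<in> Pow A" "T \<inter> F = S \<inter> F" for T
  proof -
    have "(a \<in> T) \<in> V a" if "a \<in> A" for a
    proof (cases "a \<in> F")
      case True
      then have "a \<in> T \<longleftrightarrow> a \<in> S"
        using T(2) by (metis IntD1 IntI)
      then show ?thesis
        using PiE_mem[OF V(2) \<open>a \<in> A\<close>] \<open>a \<in> A\<close> by simp
    next
      case False
      then show ?thesis
        using \<open>a \<in> A\<close> by (simp add: F_def)
    qed
    then have "?\<chi> T \<in> Pi\<^sub>E A V"
      by simp
    then have "?\<chi> T \<in> W"
      using V(3) by (rule set_mp[rotated])
    then show ?thesis
      using T(1) unfolding W(2) by simp
  qed
  moreover have "finite F" "F \<subseteq> A"
    using V(1) by (simp_all add: F_def)
  ultimately show thesis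
    by (intro that[of F]) auto
qed

text \<open>Cylinders over finite sets form a basis, so every later statement about closures becomes a statement
about agreement on finite sets.\<close>

lemma in_closure_of_powerset_top:
  assumes "\<T> \<subseteq> Pow A"
  shows "S \<in> powerset_top A closure_of \<T> \<longleftrightarrow>
    S \<subseteq> A \<and> (\<forall>F. finite F \<longrightarrow> F \<subseteq> A \<longrightarrow> (\<exists>T\<in>\<T>. T \<inter> F = S \<inter> F))"
proof (intro iffI conjI allI impI)
  assume S: "S \<in> powerset_top A closure_of \<T>"
  then show SA: "S \<subseteq> A" by (auto simp: in_closure_of)
  fix F assume "finite F" "F \<subseteq> A"
  then have "openin (powerset_top A) {T \<in> Pow A. T \<inter> F = S \<inter> F}"
    by (rule openin_cylinder)
  moreover have "S \<in> {T \<in> Pow A. T \<inter> F = S \<inter> F}"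
    using SA by simp
  ultimately obtain T where "T \<in> \<T>" "T \<in> {T \<in> Pow A. T \<inter> F = S \<inter> F}"
    using S unfolding in_closure_of by meson
  then show "\<exists>T\<in>\<T>. T \<inter> F = S \<inter> F" by auto
next
  assume *: "S \<subseteq> A \<and> (\<forall>F. finite F \<longrightarrow> F \<subseteq> A \<longrightarrow> (\<exists>T\<in>\<T>. T \<inter> F = S \<inter> F))"
  show "S \<in> powerset_top A closure_of \<T>"
    unfolding in_closure_of
  proof (intro conjI allI impI)
    fix U assume U: "S \<in> U \<and> openin (powerset_top A) U"
    then obtain F where F: "finite F" "F \<subseteq> A" "{T \<in> Pow A. T \<inter> F = S \<inter> F} \<subseteq> U"
      using openin_powerset_top_cylinder by metis
    then obtain T where "T \<in> \<T>" "T \<inter> F = S \<inter> F"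
      using * by metis
    then show "\<exists>T. T \<in> \<T> \<and> T \<in> U"
      using F(3) assms by (intro exI[of _ T]) auto
  qed (use * in auto)
qed

section \<open>The space of subgroups and minimal closed invariant sets\<close>

lemma Sub_top_eq: "Sub_top G = subtopology (powerset_top (carrier G)) {H. subgroup H G}"
proof -
  have "{H. subgroup H G} = Pow (carrier G) \<inter> {H. subgroup H G}"
    using subgroup.subset by blast
  then show ?thesis
    unfolding topology_eq Sub_top_def powerset_top_def openin_pullback_topology openin_subtopology
    by (metis Int_assoc)
qed

lemma in_closure_of_Sub_top:
  assumes "\<And>H. H \<in> \<T> \<Longrightarrow> subgroup H G"
  shows "K \<in> (Sub_top G) closure_of \<T> \<longleftrightarrow>
    subgroup K G \<and> (\<forall>F. finite F \<longrightarrow> F \<subseteq> carrier G \<longrightarrow> (\<exists>H\<in>\<T>. H \<inter> F = K \<inter> F))"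
proof -
  have "\<T> \<subseteq> Pow (carrier G)" "{H. subgroup H G} \<inter> \<T> = \<T>"
    using assms subgroup.subset by auto
  then show ?thesis
    unfolding Sub_top_eq closure_of_subtopology
    by (auto simp: in_closure_of_powerset_top dest: subgroup.subset)
qed

lemma closure_of_Sub_top_agree:
  assumes "K \<in> (Sub_top G) closure_of \<T>" "\<And>H. H \<in> \<T> \<Longrightarrow> subgroup H G"
    and "finite F" "F \<subseteq> carrier G"
  shows "\<exists>H\<in>\<T>. H \<inter> F = K \<inter> F"
  using assms in_closure_of_Sub_top[OF assms(2)] by meson

lemma topspace_Sub_top [simp]: "topspace (Sub_top G) = {H. subgroup H G}"
  by (auto simp: Sub_top_eq dest: subgroup.subset)

text \<open>Each subgroup axiom involves at most three elements at a time, so it passes to a set that agrees on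
each finite set with some subgroup.\<close>

lemma closedin_subgroups:
  assumes "group G"
  shows "closedin (powerset_top (carrier G)) {H. subgroup H G}"
proof -
  interpret group G by fact
  have sub: "{H. subgroup H G} \<subseteq> Pow (carrier G)"
    using subgroup.subset by auto
  have "subgroup K G" if K: "K \<in> (powerset_top (carrier G)) closure_of {H. subgroup H G}" for K
  proof -
    have KG: "K \<subseteq> carrier G"
      and fin: "\<And>F. finite F \<Longrightarrow> F \<subseteq> carrier G \<Longrightarrow> \<exists>H. subgroup H G \<and> H \<inter> F = K \<inter> F"
      using K in_closure_of_powerset_top[OF sub] by auto
    show ?thesis
    proof (rule subgroup.intro)
      show "x \<otimes>\<^bsub>G\<^esub> y \<in> K" if "x \<in> K" "y \<in> K" for x y
      proof -
        have F: "{x, y, x \<otimes>\<^bsub>G\<^esub> y} \<subseteq> carrier G"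
          using that KG by (simp add: subset_iff)
        obtain H where H: "subgroup H G" "H \<inter> {x, y, x \<otimes>\<^bsub>G\<^esub> y} = K \<inter> {x, y, x \<otimes>\<^bsub>G\<^esub> y}"
          using fin[OF _ F] by (meson finite.intros)
        then have "x \<in> H" "y \<in> H"
          using that by blast+
        then have "x \<otimes>\<^bsub>G\<^esub> y \<in> H"
          using H(1) by (simp add: subgroup.m_closed)
        then show ?thesis using H(2) by blast
      qed
      show "\<one>\<^bsub>G\<^esub> \<in> K"
        using fin[of "{\<one>\<^bsub>G\<^esub>}"] subgroup.one_closed by fastforce
      show "inv\<^bsub>G\<^esub> x \<in> K" if "x \<in> K" for x
      proof -
        have F: "{x, inv\<^bsub>G\<^esub> x} \<subseteq> carrier G"
          using that KG by (simp add: subset_iff)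
        obtain H where H: "subgroup H G" "H \<inter> {x, inv\<^bsub>G\<^esub> x} = K \<inter> {x, inv\<^bsub>G\<^esub> x}"
          using fin[OF _ F] by (meson finite.intros)
        then have "x \<in> H"
          using that by blast+
        then have "inv\<^bsub>G\<^esub> x \<in> H"
          using H(1) by (simp add: subgroup.m_inv_closed)
        then show ?thesis using H(2) by blast
      qed
    qed (fact KG)
  qed
  then show ?thesis
    using closure_of_subset[of "{H. subgroup H G}" "powerset_top (carrier G)"] sub
    unfolding closure_of_eq[symmetric] by auto
qed

lemma compact_Hausdorff_Sub_top:
  assumes "group G"
  shows "compact_space (Sub_top G)" "Hausdorff_space (Sub_top G)"
  unfolding Sub_top_eq
  using closedin_compact_space[OF compact_Hausdorff_powerset_top(1) closedin_subgroups[OF assms]]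
  by (auto simp: compact_space_subtopology Hausdorff_space_subtopology compact_Hausdorff_powerset_top)

lemma openin_Sub_top_cylinder:
  assumes "finite F" "F \<subseteq> carrier G"
  shows "openin (Sub_top G) {H. subgroup H G \<and> H \<inter> F = K \<inter> F}"
proof -
  have *: "{H. subgroup H G \<and> H \<inter> F = K \<inter> F}
      = {H \<in> Pow (carrier G). H \<inter> F = K \<inter> F} \<inter> {H. subgroup H G}"
    using subgroup.subset by auto
  show ?thesis
    unfolding Sub_top_eq openin_subtopology
    by (intro exI[of _ "{H \<in> Pow (carrier G). H \<inter> F = K \<inter> F}"] conjI openin_cylinder[OF assms] *)
qed

context group
begin

lemma conj_act_action: "group_action G {H. subgroup H G} (conj_act G)"
  using action_by_conjugation_on_subgroups_set unfolding conj_act_def[abs_def] .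

lemma subgroup_conj_act:
  assumes "g \<in> carrier G" "subgroup H G"
  shows "subgroup (conj_act G g H) G"
  using assms subgroup_conjugation_is_surj2 by (simp add: conj_act_def)

lemma mem_conj_act:
  assumes g: "g \<in> carrier G" and H: "subgroup H G" and a: "a \<in> carrier G"
  shows "a \<in> conj_act G g H \<longleftrightarrow> inv g \<otimes> a \<otimes> g \<in> H"
proof
  assume "a \<in> conj_act G g H"
  then obtain h where h: "h \<in> H" "a = g \<otimes> h \<otimes> inv g"
    using H by (auto simp: conj_act_def l_coset_def r_coset_def)
  then have "inv g \<otimes> a \<otimes> g = h"
    using g subgroup.mem_carrier[OF H h(1)] by (simp add: m_assoc inv_solve_left')
  then show "inv g \<otimes> a \<otimes> g \<in> H" using h by simp
next
  assume *: "inv g \<otimes> a \<otimes> g \<in> H"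
  have "a = g \<otimes> (inv g \<otimes> a \<otimes> g) \<otimes> inv g"
    using g a by (simp add: m_assoc) (simp flip: m_assoc)
  then show "a \<in> conj_act G g H"
    using * H by (auto simp: conj_act_def l_coset_def r_coset_def)
qed

definition closed_invariant :: "'a set set \<Rightarrow> bool"
  where "closed_invariant \<K> \<longleftrightarrow> \<K> \<noteq> {} \<and> closedin (Sub_top G) \<K> \<and>
    (\<forall>g\<in>carrier G. conj_act G g ` \<K> \<subseteq> \<K>)"

abbreviation orbit_closure :: "'a set \<Rightarrow> 'a set set"
  where "orbit_closure K \<equiv> (Sub_top G) closure_of (orbit G (conj_act G) K)"

lemma subgroup_closed_invariant: "closed_invariant \<K> \<Longrightarrow> K \<in> \<K> \<Longrightarrow> subgroup K G"
  unfolding closed_invariant_def using closedin_subset[of "Sub_top G" \<K>] by auto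

text \<open>Agreement of \<open>H\<close> and \<open>K\<close> on \<open>g\<inverse>Fg\<close> is agreement of their conjugates on \<open>F\<close>.\<close>

lemma closure_of_conj_act:
  assumes "\<And>H. H \<in> \<T> \<Longrightarrow> subgroup H G" and inv: "\<And>g. g \<in> carrier G \<Longrightarrow> conj_act G g ` \<T> \<subseteq> \<T>"
    and g: "g \<in> carrier G" and K: "K \<in> (Sub_top G) closure_of \<T>"
  shows "conj_act G g K \<in> (Sub_top G) closure_of \<T>"
proof -
  have sK: "subgroup K G"
    using K in_closure_of_Sub_top[OF assms(1)] by auto
  have "\<exists>H\<in>\<T>. H \<inter> F = conj_act G g K \<inter> F" if F: "finite F" "F \<subseteq> carrier G" for F
  proof -
    let ?D = "(\<lambda>a. inv g \<otimes> a \<otimes> g) ` F"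
    have "finite ?D" "?D \<subseteq> carrier G"
      using F g by auto
    then obtain H where H: "H \<in> \<T>" "H \<inter> ?D = K \<inter> ?D"
      using K in_closure_of_Sub_top[OF assms(1)] by meson
    have "a \<in> conj_act G g H \<longleftrightarrow> a \<in> conj_act G g K" if "a \<in> F" for a
    proof -
      have "inv g \<otimes> a \<otimes> g \<in> H \<longleftrightarrow> inv g \<otimes> a \<otimes> g \<in> K"
        using H(2) that by blast
      then show ?thesis
        using mem_conj_act g sK assms(1)[OF H(1)] F(2) that by (metis subsetD)
    qed
    moreover have "conj_act G g H \<in> \<T>"
      using inv[OF g] H(1) by blast
    ultimately show ?thesis by blast
  qed
  then show ?thesis
    using in_closure_of_Sub_top[OF assms(1)] subgroup_conj_act[OF g sK] by blast
qed

lemma continuous_map_conj_act: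
  assumes g: "g \<in> carrier G"
  shows "continuous_map (Sub_top G) (Sub_top G) (conj_act G g)"
proof -
  have "continuous_map (Sub_top G) (powerset_top (carrier G)) (conj_act G g)"
  proof (rule continuous_map_powerset_top)
    show "conj_act G g \<in> topspace (Sub_top G) \<rightarrow> Pow (carrier G)"
      using subgroup_conj_act[OF g] subgroup.subset by fastforce
    fix a b assume a: "a \<in> carrier G"
    let ?c = "inv g \<otimes> a \<otimes> g"
    have "{H \<in> topspace (Sub_top G). a \<in> conj_act G g H \<longleftrightarrow> b}
        = {H. subgroup H G \<and> H \<inter> {?c} = (if b then {?c} else {}) \<inter> {?c}}"
      using mem_conj_act[OF g _ a] by auto
    then show "openin (Sub_top G) {H \<in> topspace (Sub_top G). a \<in> conj_act G g H \<longleftrightarrow> b}"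
      using openin_Sub_top_cylinder[of "{?c}" G] g a by simp
  qed
  then show ?thesis
    using subgroup_conj_act[OF g] by (simp add: Sub_top_eq continuous_map_in_subtopology Pi_iff)
qed

lemma orbit_conj_act_subgroup:
  assumes "subgroup K G" "H \<in> orbit G (conj_act G) K"
  shows "subgroup H G"
  using assms subgroup_conj_act by (auto simp: orbit_def)

lemma closed_invariant_orbit_closure:
  assumes K: "subgroup K G"
  shows "closed_invariant (orbit_closure K)" "K \<in> orbit_closure K"
proof -
  interpret conj: group_action G "{H. subgroup H G}" "conj_act G"
    by (rule conj_act_action)
  have inv: "conj_act G g ` orbit G (conj_act G) K \<subseteq> orbit G (conj_act G) K" if "g \<in> carrier G" for g
    using conj.composition_rule[of K g] K that by (force simp: orbit_def)
  show "K \<in> orbit_closure K"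
    using conj.orbit_refl[of K] K closure_of_subset[of "orbit G (conj_act G) K" "Sub_top G"]
      orbit_conj_act_subgroup[OF K] by auto
  then show "closed_invariant (orbit_closure K)"
    unfolding closed_invariant_def
    using closure_of_conj_act[OF orbit_conj_act_subgroup[OF K] inv] by auto
qed

lemma orbit_closure_subset:
  assumes "closed_invariant \<K>" "K \<in> \<K>"
  shows "orbit_closure K \<subseteq> \<K>"
  using assms unfolding closed_invariant_def
  by (intro closure_of_minimal) (auto simp: orbit_def)

text \<open>Because a URS is closed, density of orbits can be tested in the whole space of subgroups, without the
subspace topology of the URS.\<close>

lemma is_URS_iff_orbit_closure:
  "is_URS G \<H> \<longleftrightarrow> closed_invariant \<H> \<and> (\<forall>K\<in>\<H>. orbit_closure K = \<H>)"
proof -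
  have "subtopology (Sub_top G) \<H> closure_of orbit G (conj_act G) K = orbit_closure K"
    if "closed_invariant \<H>" "K \<in> \<H>" for K
  proof -
    have "\<H> \<inter> orbit G (conj_act G) K = orbit G (conj_act G) K"
      using that by (auto simp: closed_invariant_def orbit_def)
    then show ?thesis
      using orbit_closure_subset[OF that] by (auto simp: closure_of_subtopology)
  qed
  moreover have "topspace (subtopology (Sub_top G) \<H>) = \<H>" if "closed_invariant \<H>"
    using subgroup_closed_invariant[OF that] by auto
  ultimately show ?thesis
    unfolding is_URS_def orbits_dense_def closed_invariant_def[symmetric]
    by (metis closed_invariant_def)
qed

end

section \<open>The URS attached to a semicontinuous equivariant map\<close>

text \<open>Continuity of \<open>f\<close> at \<open>x\<close> for the topology of \<^const>\<open>powerset_top\<close>, in terms of cylinders.\<close>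

definition continuity_point :: "'x topology \<Rightarrow> 'a set \<Rightarrow> ('x \<Rightarrow> 'a set) \<Rightarrow> 'x \<Rightarrow> bool"
  where "continuity_point X A f x \<longleftrightarrow> x \<in> topspace X \<and>
    (\<forall>F. finite F \<longrightarrow> F \<subseteq> A \<longrightarrow> (\<exists>V. openin X V \<and> x \<in> V \<and> (\<forall>y\<in>V. f y \<inter> F = f x \<inter> F)))"

text \<open>Membership of a fixed \<open>a\<close> in \<open>f x\<close> is locally constant in \<open>x\<close> except on the frontier of a closed set, which
is nowhere dense. Countably many such frontiers cannot cover a compact Hausdorff space, by Baire.\<close>

lemma ex_continuity_point:
  assumes X: "compact_space X" "Hausdorff_space X" "topspace X \<noteq> {}"
    and A: "countable A"
    and closed: "\<And>a. a \<in> A \<Longrightarrow> closedin X {x \<in> topspace X. a \<in> f x}"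
  obtains x where "continuity_point X A f x"
proof -
  define C where "C a = {x \<in> topspace X. a \<in> f x}" for a
  have "X interior_of \<Union>((\<lambda>a. X frontier_of C a) ` A) = {}"
  proof (rule Baire_category_alt)
    show "completely_metrizable_space X \<or> locally_compact_space X \<and> regular_space X"
      using X compact_imp_locally_compact_space compact_Hausdorff_imp_regular_space by blast
    fix T assume "T \<in> (\<lambda>a. X frontier_of C a) ` A"
    then obtain a where a: "a \<in> A" "T = X frontier_of C a" by blast
    have "X interior_of (X frontier_of C a) \<subseteq> X interior_of C a"
      using frontier_of_subset_closedin closed[OF a(1)] by (intro interior_of_mono) (auto simp: C_def)
    moreover have "X interior_of (X frontier_of C a) \<inter> X interior_of C a = {}"
      using interior_of_subset[of X "X frontier_of C a"] by (auto simp: frontier_of_def)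
    ultimately show "closedin X T \<and> X interior_of T = {}"
      using a by (auto simp: closedin_frontier_of)
  qed (use A in auto)
  moreover have "topspace X \<subseteq> X interior_of \<Union>((\<lambda>a. X frontier_of C a) ` A)"
    if "topspace X \<subseteq> \<Union>((\<lambda>a. X frontier_of C a) ` A)"
    by (rule interior_of_maximal[OF that openin_topspace])
  ultimately have "\<not> topspace X \<subseteq> \<Union>((\<lambda>a. X frontier_of C a) ` A)"
    using X(3) by blast
  then obtain x where x: "x \<in> topspace X" "\<And>a. a \<in> A \<Longrightarrow> x \<notin> X frontier_of C a"
    by blast
  have V: "\<exists>V. openin X V \<and> x \<in> V \<and> (\<forall>y\<in>V. a \<in> f y \<longleftrightarrow> a \<in> f x)" if "a \<in> A" for a
  proof (cases "a \<in> f x")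
    case True
    then have "x \<in> X interior_of C a"
      using x(1) x(2)[OF that] closure_of_subset[of "C a" X] by (auto simp: frontier_of_def C_def)
    then show ?thesis
      using True interior_of_subset[of X "C a"] by (intro exI[of _ "X interior_of C a"]) (auto simp: C_def)
  next
    case False
    then show ?thesis
      using x(1) closed[OF that]
      by (intro exI[of _ "topspace X - C a"]) (auto simp: C_def openin_diff)
  qed
  have "\<exists>V. openin X V \<and> x \<in> V \<and> (\<forall>y\<in>V. f y \<inter> F = f x \<inter> F)" if F: "finite F" "F \<subseteq> A" for F
  proof -
    obtain W where W: "\<And>a. a \<in> F \<Longrightarrow> openin X (W a) \<and> x \<in> W a \<and> (\<forall>y\<in>W a. a \<in> f y \<longleftrightarrow> a \<in> f x)"
      using V F(2) by (metis subsetD)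
    have "openin X (\<Inter>(insert (topspace X) (W ` F)))"
      using W F(1) by (intro openin_Inter) auto
    then show ?thesis
      using x(1) W by (intro exI[of _ "\<Inter>(insert (topspace X) (W ` F))"]) auto
  qed
  then show thesis
    using x(1) by (intro that[of x]) (auto simp: continuity_point_def)
qed

text \<open>The common features of the two maps of interest: the stabilizer map of a minimal compact space, and
the closure map \<open>H \<mapsto> cl H\<close> on a URS. The last condition is upper semicontinuity. The action enters through
continuous maps with dense orbits, so that conjugation on a URS, given by maps on all subgroups, is an instance.\<close>

locale semicontinuous_subgroup_map = group G for G (structure) +
  fixes X :: "'x topology" and \<phi> :: "'a \<Rightarrow> 'x \<Rightarrow> 'x" and f :: "'x \<Rightarrow> 'a set"
  assumes countable_G: "countable (carrier G)"
    and compact: "compact_space X" and Hausdorff: "Hausdorff_space X"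
    and nonempty: "topspace X \<noteq> {}"
    and continuous: "g \<in> carrier G \<Longrightarrow> continuous_map X X (\<phi> g)"
    and minimal: "orbits_dense G X \<phi>"
    and subgroup: "x \<in> topspace X \<Longrightarrow> subgroup (f x) G"
    and equivariant: "g \<in> carrier G \<Longrightarrow> x \<in> topspace X \<Longrightarrow> f (\<phi> g x) = conj_act G g (f x)"
    and semicontinuous: "g \<in> carrier G \<Longrightarrow> closedin X {x \<in> topspace X. g \<in> f x}"
begin

lemma finitely_many_translates_cover:
  assumes V: "openin X V" "V \<noteq> {}"
  obtains E where "finite E" "E \<subseteq> carrier G" "\<And>x. x \<in> topspace X \<Longrightarrow> \<exists>g\<in>E. \<phi> g x \<in> V"
proof -
  define U where "U g = {x \<in> topspace X. \<phi> g x \<in> V}" for g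
  have "\<exists>g\<in>carrier G. x \<in> U g" if x: "x \<in> topspace X" for x
  proof -
    have "X closure_of orbit G \<phi> x = topspace X"
      using minimal x by (simp add: orbits_dense_def)
    moreover obtain v where "v \<in> V" "v \<in> topspace X"
      using V openin_subset[OF V(1)] by blast
    ultimately have "v \<in> X closure_of orbit G \<phi> x" by simp
    then obtain y where "y \<in> orbit G \<phi> x" "y \<in> V"
      using V(1) \<open>v \<in> V\<close> unfolding in_closure_of by meson
    then show ?thesis
      using x by (auto simp: U_def orbit_def)
  qed
  then have "topspace X \<subseteq> \<Union>(U ` carrier G)" by blast
  moreover have "openin X (U g)" if "g \<in> carrier G" for g
    unfolding U_def by (rule openin_continuous_map_preimage[OF continuous[OF that] V(1)])
  ultimately obtain \<U> where \<U>: "finite \<U>" "\<U> \<subseteq> U ` carrier G" "topspace X \<subseteq> \<Union>\<U>"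
    using compact unfolding compact_space_alt by (metis (no_types, lifting) imageE)
  then obtain E where "finite E" "E \<subseteq> carrier G" "\<U> = U ` E"
    by (meson finite_subset_image)
  with \<U> show thesis
    by (intro that[of E]) (auto simp: U_def)
qed

text \<open>Near the continuity point \<open>x\<close> all values of \<open>f\<close> agree with \<open>f x\<close> on a given finite set, and by minimality
every point can be moved near \<open>x\<close> by one of finitely many group elements. So every value of \<open>f\<close> has a
conjugate, by one of finitely many elements, that agrees with \<open>f x\<close> on the finite set. This property
involves only finitely many elements of \<open>G\<close>, hence passes to the closure of the image of \<open>f\<close>. A non-empty
closed invariant set there therefore comes arbitrarily close to \<open>f x\<close>.\<close>

lemma value_at_continuity_point_mem:
  assumes x: "continuity_point X (carrier G) f x"
    and \<K>: "closed_invariant \<K>" "\<K> \<subseteq> (Sub_top G) closure_of (f ` topspace X)"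
  shows "f x \<in> \<K>"
proof -
  obtain K where K: "K \<in> \<K>" "subgroup K G"
    using \<K>(1) subgroup_closed_invariant by (metis all_not_in_conv closed_invariant_def)
  have xX: "x \<in> topspace X" using x by (simp add: continuity_point_def)
  have "\<exists>H\<in>\<K>. H \<inter> F = f x \<inter> F" if F: "finite F" "F \<subseteq> carrier G" for F
  proof -
    obtain V where V: "openin X V" "x \<in> V" "\<And>y. y \<in> V \<Longrightarrow> f y \<inter> F = f x \<inter> F"
      using x F unfolding continuity_point_def by meson
    obtain E where E: "finite E" "E \<subseteq> carrier G" "\<And>x. x \<in> topspace X \<Longrightarrow> \<exists>g\<in>E. \<phi> g x \<in> V"
      using finitely_many_translates_cover[OF V(1)] V(2) by blast
    \<comment> \<open>all elements that decide what a conjugate by a member of \<open>E\<close> has in common with \<open>F\<close>\<close>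
    define D where "D = (\<lambda>(g, a). inv g \<otimes> a \<otimes> g) ` (E \<times> F)"
    have D: "finite D" "D \<subseteq> carrier G"
      unfolding D_def using E(1,2) F by (simp, auto simp: subset_iff)
    have sf: "subgroup H G" if "H \<in> f ` topspace X" for H
      using that subgroup by auto
    have "K \<in> (Sub_top G) closure_of (f ` topspace X)"
      using K(1) \<K>(2) by blast
    then have "\<exists>H\<in>f ` topspace X. H \<inter> D = K \<inter> D"
      using sf D by (rule closure_of_Sub_top_agree)
    then obtain y where y: "y \<in> topspace X" "f y \<inter> D = K \<inter> D"
      unfolding bex_simps by (rule bexE)
    then obtain g where g: "g \<in> E" "\<phi> g y \<in> V"
      using E(3) by meson
    have gG: "g \<in> carrier G" using g(1) E(2) by blast
    have "a \<in> conj_act G g K \<longleftrightarrow> a \<in> f x" if "a \<in> F" for a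
    proof -
      have a: "a \<in> carrier G" using that F by blast
      have "inv g \<otimes> a \<otimes> g \<in> D"
        unfolding D_def using that g(1) by (intro image_eqI[of _ _ "(g, a)"]) auto
      then have "inv g \<otimes> a \<otimes> g \<in> K \<longleftrightarrow> inv g \<otimes> a \<otimes> g \<in> f y"
        using y(2) by blast
      then have "a \<in> conj_act G g K \<longleftrightarrow> a \<in> f (\<phi> g y)"
        unfolding equivariant[OF gG y(1)] mem_conj_act[OF gG K(2) a]
          mem_conj_act[OF gG subgroup[OF y(1)] a] .
      then show ?thesis
        using V(3)[OF g(2)] that by (metis IntD1 IntI)
    qed
    moreover have "conj_act G g K \<in> \<K>"
      using \<K>(1) K(1) gG by (auto simp: closed_invariant_def)
    ultimately show ?thesis by blast
  qed
  then have "f x \<in> (Sub_top G) closure_of \<K>"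
    using in_closure_of_Sub_top[OF subgroup_closed_invariant[OF \<K>(1)]] subgroup[OF xX] by simp
  moreover have "(Sub_top G) closure_of \<K> = \<K>"
    using \<K>(1) unfolding closed_invariant_def by (intro closure_of_closedin) blast
  ultimately show ?thesis by simp
qed

lemma orbit_closure_value_subset:
  assumes x: "x \<in> topspace X"
  shows "orbit_closure (f x) \<subseteq> (Sub_top G) closure_of (f ` topspace X)"
proof (rule closure_of_mono)
  have "conj_act G g (f x) \<in> f ` topspace X" if "g \<in> carrier G" for g
    unfolding equivariant[OF that x, symmetric]
    using continuous_map_image_subset_topspace[OF continuous[OF that]] x by blast
  then show "orbit G (conj_act G) (f x) \<subseteq> f ` topspace X" by (auto simp: orbit_def)
qed

text \<open>Existence and uniqueness at once: every non-empty closed invariant subset of the closure of the image contains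
\<open>f x\<close>, so the orbit closure of \<open>f x\<close> is the least such set.\<close>

theorem URS_in_closure_iff:
  assumes x: "continuity_point X (carrier G) f x"
  shows "is_URS G \<K> \<and> \<K> \<subseteq> (Sub_top G) closure_of (f ` topspace X) \<longleftrightarrow> \<K> = orbit_closure (f x)"
proof -
  have xX: "x \<in> topspace X" using x by (simp add: continuity_point_def)
  have fx: "subgroup (f x) G" by (rule subgroup[OF xX])
  note sub = orbit_closure_value_subset[OF xX]
  have "orbit_closure K = orbit_closure (f x)" if K: "K \<in> orbit_closure (f x)" for K
  proof
    have sK: "subgroup K G"
      using K subgroup_closed_invariant closed_invariant_orbit_closure(1)[OF fx] by blast
    show le: "orbit_closure K \<subseteq> orbit_closure (f x)"
      by (rule orbit_closure_subset[OF closed_invariant_orbit_closure(1)[OF fx] K])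
    have "f x \<in> orbit_closure K"
      using value_at_continuity_point_mem[OF x closed_invariant_orbit_closure(1)[OF sK]] le sub by blast
    then show "orbit_closure (f x) \<subseteq> orbit_closure K"
      by (rule orbit_closure_subset[OF closed_invariant_orbit_closure(1)[OF sK]])
  qed
  then have URS: "is_URS G (orbit_closure (f x))"
    unfolding is_URS_iff_orbit_closure using closed_invariant_orbit_closure(1)[OF fx] by fast
  show ?thesis
  proof (intro iffI)
    assume *: "is_URS G \<K> \<and> \<K> \<subseteq> (Sub_top G) closure_of (f ` topspace X)"
    then have \<K>: "closed_invariant \<K>" "\<forall>K\<in>\<K>. orbit_closure K = \<K>"
      using is_URS_iff_orbit_closure by blast+
    have "f x \<in> \<K>"
      using * by (intro value_at_continuity_point_mem[OF x \<K>(1)]) blast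
    then show "\<K> = orbit_closure (f x)"
      using \<K>(2) by simp
  qed (use URS sub in simp)
qed

definition image_URS :: "'a set set"
  where "image_URS = (THE \<K>. is_URS G \<K> \<and> \<K> \<subseteq> (Sub_top G) closure_of (f ` topspace X))"

text \<open>This recognizes the URS from a single value of \<open>f\<close>, at any point: the orbit closure of that value lies
in the closure of the image, where there is only one URS.\<close>

corollary image_URS_eq:
  assumes \<H>: "is_URS G \<H>" and x: "x \<in> topspace X" "f x \<in> \<H>"
  shows "image_URS = \<H>"
proof -
  obtain y where y: "continuity_point X (carrier G) f y"
    using ex_continuity_point[OF compact Hausdorff nonempty countable_G semicontinuous] by blast
  have "orbit_closure (f x) = \<H>"
    using \<H> x(2) unfolding is_URS_iff_orbit_closure by blast
  then have "\<H> = orbit_closure (f y)"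
    using \<H> orbit_closure_value_subset[OF x(1)] unfolding URS_in_closure_iff[OF y, symmetric] by simp
  then show ?thesis
    unfolding image_URS_def URS_in_closure_iff[OF y] by simp
qed

corollary ex_value_in_image_URS: "\<exists>x\<in>topspace X. f x \<in> image_URS"
proof -
  obtain y where y: "continuity_point X (carrier G) f y"
    using ex_continuity_point[OF compact Hausdorff nonempty countable_G semicontinuous] by blast
  then have yX: "y \<in> topspace X" by (simp add: continuity_point_def)
  have "f y \<in> orbit_closure (f y)"
    by (rule closed_invariant_orbit_closure(2)[OF subgroup[OF yX]])
  then show ?thesis
    using yX unfolding image_URS_def URS_in_closure_iff[OF y] by auto
qed

end

section \<open>Point stabilizers\<close>

text \<open>Fixed-point sets of continuous maps of a Hausdorff space are closed, which gives semicontinuity.\<close>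

lemma stabilizer_semicontinuous_subgroup_map:
  assumes "group G" "countable (carrier G)" and X: "compact_G_space G X \<phi>" and min: "minimal_G_space G X \<phi>"
  shows "semicontinuous_subgroup_map G X \<phi> (stabilizer G \<phi>)"
proof -
  interpret group G by fact
  interpret group_action G "topspace X" \<phi>
    using X by (simp add: compact_G_space_def G_space_def)
  have cont: "continuous_map X X (\<phi> g)" if "g \<in> carrier G" for g
    using X that by (simp add: compact_G_space_def G_space_def homeomorphic_imp_continuous_map)
  have Haus: "Hausdorff_space X"
    using X by (simp add: compact_G_space_def)
  show ?thesis
  proof (intro semicontinuous_subgroup_map.intro semicontinuous_subgroup_map_axioms.intro)
    fix x assume x: "x \<in> topspace X"
    show "subgroup (stabilizer G \<phi> x) G"
      by (rule stabilizer_subgroup[OF x])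
    fix g assume g: "g \<in> carrier G"
    have "a \<in> stabilizer G \<phi> (\<phi> g x) \<longleftrightarrow> a \<in> conj_act G g (stabilizer G \<phi> x)"
      if a: "a \<in> carrier G" for a
    proof -
      have "\<phi> (inv\<^bsub>G\<^esub> g \<otimes>\<^bsub>G\<^esub> a \<otimes>\<^bsub>G\<^esub> g) x = \<phi> (inv\<^bsub>G\<^esub> g) (\<phi> a (\<phi> g x))"
        using composition_rule x g a element_image[OF g x refl] by simp
      moreover have "\<phi> (inv\<^bsub>G\<^esub> g) (\<phi> a (\<phi> g x)) = x \<longleftrightarrow> \<phi> a (\<phi> g x) = \<phi> g x"
        using orbit_sym_aux[OF g x refl] inj_prop[OF inv_closed[OF g]] x g a element_image
        by (metis inj_onD)
      ultimately show ?thesis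
        using a g unfolding mem_conj_act[OF g stabilizer_subgroup[OF x] a]
        by (simp add: stabilizer_def)
    qed
    moreover have "stabilizer G \<phi> (\<phi> g x) \<subseteq> carrier G" "conj_act G g (stabilizer G \<phi> x) \<subseteq> carrier G"
      using subgroup_conj_act[OF g stabilizer_subgroup[OF x]] subgroup.subset
      by (auto simp: stabilizer_def)
    ultimately show "stabilizer G \<phi> (\<phi> g x) = conj_act G g (stabilizer G \<phi> x)"
      by blast
  next
    fix g assume g: "g \<in> carrier G"
    have "{x \<in> topspace X. g \<in> stabilizer G \<phi> x} = {x \<in> topspace X. \<phi> g x = x}"
      using g by (auto simp: stabilizer_def)
    then show "closedin X {x \<in> topspace X. g \<in> stabilizer G \<phi> x}"
      using closedin_continuous_maps_eq[OF Haus cont[OF g] continuous_map_id] by simp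
  qed (use assms cont in \<open>auto simp: compact_G_space_def G_space_def minimal_G_space_def\<close>)
qed

section \<open>Closures of subgroups in the coset topology\<close>

context group
begin

lemma mem_l_coset_self:
  assumes "g \<in> carrier G" "subgroup N G"
  shows "g \<in> g <# N"
proof -
  have "g \<otimes> \<one> \<in> g <# N"
    using subgroup.one_closed[OF assms(2)] unfolding l_coset_def by blast
  then show ?thesis using assms(1) by simp
qed

lemma subgroup_set_mult_normal:
  assumes "subgroup H G" "N \<lhd> G"
  shows "subgroup (H <#> N) G"
  using mult_norm_subgroup[OF assms(2,1)] commut_normal[OF assms] by simp

lemma mem_set_mult:
  assumes H: "subgroup H G" and N: "N \<subseteq> carrier G" and a: "a \<in> carrier G"
  shows "a \<in> H <#> N \<longleftrightarrow> (\<exists>h\<in>H. inv h \<otimes> a \<in> N)"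
proof
  assume "a \<in> H <#> N"
  then obtain h n where "h \<in> H" "n \<in> N" "a = h \<otimes> n"
    by (auto simp: set_mult_def)
  then show "\<exists>h\<in>H. inv h \<otimes> a \<in> N"
    using subgroup.mem_carrier[OF H] N by (intro bexI[of _ h]) (auto simp: subset_iff simp flip: m_assoc)
next
  assume "\<exists>h\<in>H. inv h \<otimes> a \<in> N"
  then obtain h where h: "h \<in> H" "inv h \<otimes> a \<in> N" by blast
  moreover have "a = h \<otimes> (inv h \<otimes> a)"
    using subgroup.mem_carrier[OF H h(1)] a by (simp flip: m_assoc)
  ultimately show "a \<in> H <#> N"
    unfolding set_mult_def by blast
qed

lemma conj_act_set_mult:
  assumes g: "g \<in> carrier G" and H: "subgroup H G" and N: "N \<lhd> G"
  shows "conj_act G g (H <#> N) = conj_act G g H <#> N"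
proof -
  interpret N: normal N G by fact
  have HN: "subgroup (H <#> N) G"
    by (rule subgroup_set_mult_normal[OF H N])
  have gH: "subgroup (conj_act G g H) G"
    by (rule subgroup_conj_act[OF g H])
  have "a \<in> conj_act G g (H <#> N) \<longleftrightarrow> a \<in> conj_act G g H <#> N" if a: "a \<in> carrier G" for a
  proof -
    have conj_eq: "inv (g \<otimes> h \<otimes> inv g) \<otimes> a = g \<otimes> (inv h \<otimes> (inv g \<otimes> a \<otimes> g)) \<otimes> inv g"
      if "h \<in> carrier G" for h
      using that g a by (simp add: inv_mult_group m_assoc)
    have norm: "x \<in> N \<longleftrightarrow> g \<otimes> x \<otimes> inv g \<in> N" if "x \<in> carrier G" for x
    proof
      assume "g \<otimes> x \<otimes> inv g \<in> N"
      then have "inv g \<otimes> (g \<otimes> x \<otimes> inv g) \<otimes> g \<in> N"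
        by (rule N.inv_op_closed1[OF g])
      moreover have "inv g \<otimes> (g \<otimes> x \<otimes> inv g) \<otimes> g = x"
        using g that by (simp add: m_assoc) (simp flip: m_assoc)
      ultimately show "x \<in> N" by simp
    qed (rule N.inv_op_closed2[OF g])
    have "a \<in> conj_act G g (H <#> N) \<longleftrightarrow> (\<exists>h\<in>H. inv h \<otimes> (inv g \<otimes> a \<otimes> g) \<in> N)"
      using mem_conj_act[OF g HN a] mem_set_mult[OF H N.subset] g a by simp
    also have "\<dots> \<longleftrightarrow> (\<exists>h\<in>H. inv (g \<otimes> h \<otimes> inv g) \<otimes> a \<in> N)"
    proof (rule bex_cong[OF refl])
      fix h assume "h \<in> H"
      then have h: "h \<in> carrier G" by (rule subgroup.mem_carrier[OF H])
      then show "inv h \<otimes> (inv g \<otimes> a \<otimes> g) \<in> N \<longleftrightarrow> inv (g \<otimes> h \<otimes> inv g) \<otimes> a \<in> N"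
        unfolding conj_eq[OF h] using g a by (intro norm) simp
    qed
    also have "\<dots> \<longleftrightarrow> (\<exists>h\<in>conj_act G g H. inv h \<otimes> a \<in> N)"
      using H unfolding conj_act_def by (auto simp: l_coset_def r_coset_def)
    also have "\<dots> \<longleftrightarrow> a \<in> conj_act G g H <#> N"
      using mem_set_mult[OF gH N.subset a] by simp
    finally show ?thesis .
  qed
  then show ?thesis
    using subgroup.subset[OF subgroup_conj_act[OF g HN]]
      subgroup.subset[OF subgroup_set_mult_normal[OF gH N]] by blast
qed

text \<open>The image of \<open>H\<close> in \<open>G/N\<close>. It determines \<open>HN\<close>, and its size is the quantity that minimality forces to be
constant on a URS.\<close>

definition cosets_meeting :: "'a set \<Rightarrow> 'a set \<Rightarrow> 'a set set"
  where "cosets_meeting N H = (\<lambda>h. N #> h) ` H"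

lemma mem_set_mult_iff_coset_meets:
  assumes H: "subgroup H G" and N: "N \<lhd> G" and a: "a \<in> carrier G"
  shows "a \<in> H <#> N \<longleftrightarrow> N #> a \<in> cosets_meeting N H"
proof -
  interpret N: normal N G by fact
  have "a \<in> H <#> N \<longleftrightarrow> a \<in> N <#> H"
    using commut_normal[OF H N] by simp
  also have "\<dots> \<longleftrightarrow> (\<exists>h\<in>H. a \<in> N #> h)"
    by (auto simp: set_mult_def r_coset_def)
  also have "\<dots> \<longleftrightarrow> (\<exists>h\<in>H. N #> a = N #> h)"
    using subgroup.mem_carrier[OF H] a N.subgroup_axioms
    by (metis rcos_self repr_independence)
  finally show ?thesis
    by (auto simp: cosets_meeting_def)
qed

lemma cosets_meeting_subset:
  "subgroup H G \<Longrightarrow> cosets_meeting N H \<subseteq> rcosets N"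
  using subgroup.mem_carrier by (fastforce simp: cosets_meeting_def RCOSETS_def)

lemma card_cosets_meeting_conj_act_le:
  assumes g: "g \<in> carrier G" and H: "subgroup H G" and N: "N \<lhd> G" "finite (rcosets N)"
  shows "card (cosets_meeting N (conj_act G g H)) \<le> card (cosets_meeting N H)"
proof -
  interpret N: normal N G by fact
  have "cosets_meeting N (conj_act G g H) \<subseteq> (\<lambda>C. g <# C #> inv g) ` cosets_meeting N H"
  proof
    fix C assume "C \<in> cosets_meeting N (conj_act G g H)"
    then obtain h where h: "h \<in> H" "C = N #> (g \<otimes> h \<otimes> inv g)"
      using H by (auto simp: cosets_meeting_def conj_act_def l_coset_def r_coset_def)
    have hG: "h \<in> carrier G" by (rule subgroup.mem_carrier[OF H h(1)])
    have "g <# (N #> h) #> inv g = (g <# N) #> h #> inv g"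
      using g hG N.subset by (simp add: coset_assoc)
    also have "\<dots> = (N #> g) #> h #> inv g"
      using N.coset_eq g by simp
    also have "\<dots> = C"
      using g hG N.subset h(2) by (simp add: coset_mult_assoc)
    finally show "C \<in> (\<lambda>C. g <# C #> inv g) ` cosets_meeting N H"
      using h(1) unfolding cosets_meeting_def by blast
  qed
  moreover have "finite (cosets_meeting N H)"
    using cosets_meeting_subset[OF H] N(2) finite_subset by blast
  ultimately show ?thesis by (rule surj_card_le[rotated])
qed

text \<open>Let \<open>M\<close> realize the maximum of these sizes on the URS. Finitely many elements of \<open>M\<close> represent its image in
\<open>G/N\<close>. By minimality any other member \<open>L\<close> has a conjugate that contains them, so the image of \<open>L\<close> is at least
as large.\<close>

lemma card_cosets_meeting_const:
  assumes \<H>: "is_URS G \<H>" and N: "N \<lhd> G" "finite (rcosets N)" and "H \<in> \<H>" "K \<in> \<H>"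
  shows "card (cosets_meeting N H) = card (cosets_meeting N K)"
proof -
  have ci: "closed_invariant \<H>" and orb: "\<And>K. K \<in> \<H> \<Longrightarrow> orbit_closure K = \<H>"
    using \<H> unfolding is_URS_iff_orbit_closure by blast+
  note sub = subgroup_closed_invariant[OF ci]
  have bound: "card (cosets_meeting N L) < Suc (card (rcosets N))" if "L \<in> \<H>" for L
    using card_mono[OF N(2) cosets_meeting_subset[OF sub[OF that]]] by simp
  then obtain M where M: "M \<in> \<H>" "\<And>L. L \<in> \<H> \<Longrightarrow> card (cosets_meeting N L) \<le> card (cosets_meeting N M)"
    using ex_has_greatest_nat[of "\<lambda>L. L \<in> \<H>" H "\<lambda>L. card (cosets_meeting N L)"] assms(4) by blast
  have "card (cosets_meeting N L) = card (cosets_meeting N M)" if L: "L \<in> \<H>" for L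
  proof (rule antisym[OF M(2)[OF L]])
    obtain F where F: "F \<subseteq> M" "finite F" "cosets_meeting N M = (\<lambda>h. N #> h) ` F"
      using finite_subset_image[of "cosets_meeting N M" "\<lambda>h. N #> h" M]
        finite_subset[OF cosets_meeting_subset[OF sub[OF M(1)]] N(2)]
      unfolding cosets_meeting_def by blast
    have "F \<subseteq> carrier G"
      using F(1) subgroup.subset[OF sub[OF M(1)]] by blast
    then have "\<exists>L'\<in>orbit G (conj_act G) L. L' \<inter> F = M \<inter> F"
      using orb[OF L] M(1) F(2) orbit_conj_act_subgroup[OF sub[OF L]]
      by (intro closure_of_Sub_top_agree) auto
    then obtain g where g: "g \<in> carrier G" "conj_act G g L \<inter> F = M \<inter> F"
      by (auto simp: orbit_def)
    then have "F \<subseteq> conj_act G g L"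
      using F(1) by blast
    then have "cosets_meeting N M \<subseteq> cosets_meeting N (conj_act G g L)"
      unfolding F(3) by (auto simp: cosets_meeting_def)
    moreover have "finite (cosets_meeting N (conj_act G g L))"
      using cosets_meeting_subset[OF subgroup_conj_act[OF g(1) sub[OF L]]] N(2) finite_subset by blast
    ultimately have "card (cosets_meeting N M) \<le> card (cosets_meeting N (conj_act G g L))"
      by (intro card_mono)
    also have "\<dots> \<le> card (cosets_meeting N L)"
      by (rule card_cosets_meeting_conj_act_le[OF g(1) sub[OF L] N])
    finally show "card (cosets_meeting N M) \<le> card (cosets_meeting N L)" .
  qed
  then show ?thesis using assms(4,5) by simp
qed

text \<open>In general \<open>{H. a \<in> HN}\<close> is only open, as \<open>HN\<close> can grow under a small change of \<open>H\<close> but not shrink. On a URS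
growth is excluded too, because the image in \<open>G/N\<close> has constant finite size. So \<open>H \<mapsto> HN\<close> is locally
constant there.\<close>

lemma closedin_mem_set_mult_normal:
  assumes \<H>: "is_URS G \<H>" and N: "N \<lhd> G" "finite (rcosets N)" and a: "a \<in> carrier G"
  shows "closedin (subtopology (Sub_top G) \<H>) {H \<in> \<H>. a \<in> H <#> N}"
proof -
  have ci: "closed_invariant \<H>"
    using \<H> unfolding is_URS_iff_orbit_closure by blast
  note sub = subgroup_closed_invariant[OF ci]
  have top: "topspace (subtopology (Sub_top G) \<H>) = \<H>"
    using sub by auto
  have "openin (subtopology (Sub_top G) \<H>) {H \<in> \<H>. a \<notin> H <#> N}"
  proof (subst openin_subopen, intro ballI)
    fix H assume "H \<in> {H \<in> \<H>. a \<notin> H <#> N}"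
    then have H: "H \<in> \<H>" "a \<notin> H <#> N" by auto
    obtain F where F: "F \<subseteq> H" "finite F" "cosets_meeting N H = (\<lambda>h. N #> h) ` F"
      using finite_subset_image[of "cosets_meeting N H" "\<lambda>h. N #> h" H]
        finite_subset[OF cosets_meeting_subset[OF sub[OF H(1)]] N(2)]
      unfolding cosets_meeting_def by blast
    define V where "V = {K. subgroup K G \<and> K \<inter> F = H \<inter> F} \<inter> \<H>"
    have "F \<subseteq> carrier G"
      using F(1) subgroup.subset[OF sub[OF H(1)]] by blast
    then have "openin (subtopology (Sub_top G) \<H>) V"
      unfolding V_def openin_subtopology using openin_Sub_top_cylinder[OF F(2)] by metis
    moreover have "H \<in> V"
      using H(1) sub by (simp add: V_def)
    moreover have "a \<notin> K <#> N" if K: "K \<in> V" for K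
    proof -
      have K': "K \<in> \<H>" "F \<subseteq> K" using K F(1) by (auto simp: V_def)
      have "cosets_meeting N H \<subseteq> cosets_meeting N K"
        unfolding F(3) using K'(2) by (auto simp: cosets_meeting_def)
      moreover have "finite (cosets_meeting N K)"
        using cosets_meeting_subset[OF sub[OF K'(1)]] N(2) finite_subset by blast
      ultimately have "cosets_meeting N H = cosets_meeting N K"
        using card_cosets_meeting_const[OF \<H> N H(1) K'(1)] by (intro card_subset_eq)
      then show ?thesis
        using H(2) mem_set_mult_iff_coset_meets[OF sub[OF H(1)] N(1) a]
          mem_set_mult_iff_coset_meets[OF sub[OF K'(1)] N(1) a] by simp
    qed
    ultimately show "\<exists>T. openin (subtopology (Sub_top G) \<H>) T \<and> H \<in> T \<and> T \<subseteq> {H \<in> \<H>. a \<notin> H <#> N}"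
      by (intro exI[of _ V]) (auto simp: V_def)
  qed
  moreover have "\<H> - {H \<in> \<H>. a \<in> H <#> N} = {H \<in> \<H>. a \<notin> H <#> N}" by blast
  ultimately show ?thesis
    unfolding closedin_def top by auto
qed

end

locale finite_index_family = group G for G (structure) +
  fixes \<N> :: "'a set set"
  assumes nonempty_family: "\<N> \<noteq> {}" and filtering_family: "filtering \<N>"
    and normal_family: "N \<in> \<N> \<Longrightarrow> N \<lhd> G" and finite_index: "N \<in> \<N> \<Longrightarrow> finite (rcosets N)"
begin

lemma subgroup_cl_subgroup:
  assumes "subgroup H G"
  shows "subgroup (cl_subgroup G \<N> H) G"
  unfolding cl_subgroup_def using nonempty_family
  by (intro subgroups_Inter) (auto intro!: subgroup_set_mult_normal normal_family assms)

lemma cl_subgroup_superset: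
  assumes "subgroup H G"
  shows "H \<subseteq> cl_subgroup G \<N> H"
proof -
  have "h \<in> H <#> N" if "h \<in> H" "N \<in> \<N>" for h N
  proof -
    have "h \<otimes> \<one> \<in> H <#> N"
      using that subgroup.one_closed[OF normal_imp_subgroup[OF normal_family]]
      unfolding set_mult_def by blast
    then show ?thesis
      using subgroup.mem_carrier[OF assms that(1)] by simp
  qed
  then show ?thesis by (auto simp: cl_subgroup_def)
qed

lemma cl_subgroup_idem:
  assumes "subgroup H G"
  shows "cl_subgroup G \<N> (cl_subgroup G \<N> H) = cl_subgroup G \<N> H"
proof
  show "cl_subgroup G \<N> H \<subseteq> cl_subgroup G \<N> (cl_subgroup G \<N> H)"
    by (rule cl_subgroup_superset[OF subgroup_cl_subgroup[OF assms]])
  have "cl_subgroup G \<N> H <#> N \<subseteq> H <#> N" if N: "N \<in> \<N>" for N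
  proof -
    have sN: "subgroup N G"
      by (rule normal_imp_subgroup[OF normal_family[OF N]])
    have "cl_subgroup G \<N> H <#> N \<subseteq> (H <#> N) <#> N"
      using N by (intro mono_set_mult) (auto simp: cl_subgroup_def)
    also have "\<dots> = H <#> (N <#> N)"
      using subgroup.subset[OF assms] subgroup.subset[OF sN] by (simp add: set_mult_assoc)
    also have "N <#> N = N"
      by (rule subgroup_mult_id[OF sN])
    finally show ?thesis .
  qed
  then show "cl_subgroup G \<N> (cl_subgroup G \<N> H) \<subseteq> cl_subgroup G \<N> H"
    unfolding cl_subgroup_def by blast
qed

lemma cl_subgroup_conj_act:
  assumes g: "g \<in> carrier G" and H: "subgroup H G"
  shows "cl_subgroup G \<N> (conj_act G g H) = conj_act G g (cl_subgroup G \<N> H)"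
proof -
  have "a \<in> cl_subgroup G \<N> (conj_act G g H) \<longleftrightarrow> a \<in> conj_act G g (cl_subgroup G \<N> H)"
    if a: "a \<in> carrier G" for a
  proof -
    have "a \<in> conj_act G g H <#> N \<longleftrightarrow> inv g \<otimes> a \<otimes> g \<in> H <#> N" if "N \<in> \<N>" for N
      using conj_act_set_mult[OF g H normal_family[OF that]]
        mem_conj_act[OF g subgroup_set_mult_normal[OF H normal_family[OF that]] a] by simp
    then show ?thesis
      unfolding mem_conj_act[OF g subgroup_cl_subgroup[OF H] a] by (simp add: cl_subgroup_def)
  qed
  then show ?thesis
    using subgroup.subset[OF subgroup_cl_subgroup[OF subgroup_conj_act[OF g H]]]
      subgroup.subset[OF subgroup_conj_act[OF g subgroup_cl_subgroup[OF H]]] by blast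
qed

text \<open>An intersection of locally constant maps is upper semicontinuous.\<close>

lemma cl_subgroup_semicontinuous_subgroup_map:
  assumes "countable (carrier G)" and \<H>: "is_URS G \<H>"
  shows "semicontinuous_subgroup_map G (subtopology (Sub_top G) \<H>) (conj_act G) (cl_subgroup G \<N>)"
proof -
  have ci: "closed_invariant \<H>"
    using \<H> unfolding is_URS_iff_orbit_closure by blast
  note sub = subgroup_closed_invariant[OF ci]
  have top: "topspace (subtopology (Sub_top G) \<H>) = \<H>"
    using sub by auto
  have closed: "closedin (Sub_top G) \<H>" and ne: "\<H> \<noteq> {}" and inv: "\<And>g. g \<in> carrier G \<Longrightarrow> conj_act G g ` \<H> \<subseteq> \<H>"
    using ci by (auto simp: closed_invariant_def)
  show ?thesis
  proof (intro semicontinuous_subgroup_map.intro semicontinuous_subgroup_map_axioms.intro)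
    show "group G" by (rule is_group)
    show "countable (carrier G)" by fact
    show "compact_space (subtopology (Sub_top G) \<H>)"
      using closedin_compact_space[OF compact_Hausdorff_Sub_top(1)[OF is_group] closed]
      by (rule compact_space_subtopology)
    show "Hausdorff_space (subtopology (Sub_top G) \<H>)"
      by (rule Hausdorff_space_subtopology[OF compact_Hausdorff_Sub_top(2)[OF is_group]])
    show "orbits_dense G (subtopology (Sub_top G) \<H>) (conj_act G)"
      using \<H> by (simp add: is_URS_def)
    show "topspace (subtopology (Sub_top G) \<H>) \<noteq> {}"
      unfolding top by (rule ne)
  next
    fix g assume g: "g \<in> carrier G"
    show "closedin (subtopology (Sub_top G) \<H>)
            {H \<in> topspace (subtopology (Sub_top G) \<H>). g \<in> cl_subgroup G \<N> H}"
    proof -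
      have "{H \<in> topspace (subtopology (Sub_top G) \<H>). g \<in> cl_subgroup G \<N> H}
          = (\<Inter>N\<in>\<N>. {H \<in> \<H>. g \<in> H <#> N})"
        unfolding top cl_subgroup_def using nonempty_family by blast
      also have "closedin (subtopology (Sub_top G) \<H>) \<dots>"
        using nonempty_family closedin_mem_set_mult_normal[OF \<H> normal_family finite_index g]
        by (intro closedin_Inter) auto
      finally show ?thesis .
    qed
    show "continuous_map (subtopology (Sub_top G) \<H>) (subtopology (Sub_top G) \<H>) (conj_act G g)"
      using continuous_map_conj_act[OF g] inv[OF g] 
      by (auto simp: continuous_map_in_subtopology continuous_map_from_subtopology)
  next
    fix g H assume "g \<in> carrier G" "H \<in> topspace (subtopology (Sub_top G) \<H>)"
    then show "cl_subgroup G \<N> (conj_act G g H) = conj_act G g (cl_subgroup G \<N> H)"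
      using cl_subgroup_conj_act sub top by blast
  next
    fix H assume "H \<in> topspace (subtopology (Sub_top G) \<H>)"
    then show "subgroup (cl_subgroup G \<N> H) G"
      using subgroup_cl_subgroup sub top by blast
  qed
qed

text \<open>The filtering property makes the generating cosets a basis of neighbourhoods.\<close>

lemma coset_in_open_coset_topology:
  assumes "openin (coset_topology G \<N>) U" "g \<in> U"
  shows "\<exists>N\<in>\<N>. g <# N \<subseteq> U"
proof -
  have "generate_topology_on {g <# N | g N. g \<in> carrier G \<and> N \<in> \<N>} U"
    using assms(1) unfolding coset_topology_def openin_topology_generated_by_iff .
  then show ?thesis using assms(2)
  proof induction
    case (Int U V)
    then obtain N1 N2 where N12: "N1 \<in> \<N>" "g <# N1 \<subseteq> U" "N2 \<in> \<N>" "g <# N2 \<subseteq> V" by blast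
    then obtain N3 where N3: "N3 \<in> \<N>" "N3 \<subseteq> N1 \<inter> N2"
      using filtering_family unfolding filtering_def by blast
    then have "g <# N3 \<subseteq> g <# N1" "g <# N3 \<subseteq> g <# N2"
      by (auto simp: l_coset_def)
    then show ?case using N12 N3(1) by blast
  next
    case (Basis U)
    then obtain h N where hN: "U = h <# N" "h \<in> carrier G" "N \<in> \<N>" by blast
    have sN: "subgroup N G"
      by (rule normal_imp_subgroup[OF normal_family[OF hN(3)]])
    obtain n where n: "n \<in> N" "g = h \<otimes> n"
      using Basis(2) hN(1) by (auto simp: l_coset_def)
    have "g <# N \<subseteq> U"
    proof
      fix x assume "x \<in> g <# N"
      then obtain m where m: "m \<in> N" "x = g \<otimes> m" by (auto simp: l_coset_def)
      then have "x = h \<otimes> (n \<otimes> m)"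
        using n hN(2) subgroup.mem_carrier[OF sN] by (simp add: m_assoc)
      then show "x \<in> U"
        using subgroup.m_closed[OF sN n(1) m(1)] unfolding hN(1) l_coset_def by blast
    qed
    then show ?case using hN(3) by blast
  qed blast+
qed

lemma topspace_coset_topology: "topspace (coset_topology G \<N>) = carrier G"
proof -
  have "g \<in> g <# N" if "g \<in> carrier G" "N \<in> \<N>" for g N
    by (rule mem_l_coset_self[OF that(1) normal_imp_subgroup[OF normal_family[OF that(2)]]])
  moreover have "g <# N \<subseteq> carrier G" if "g \<in> carrier G" "N \<in> \<N>" for g N
    using l_coset_subset_G subgroup.subset[OF normal_imp_subgroup[OF normal_family[OF that(2)]]] that(1)
    by blast
  ultimately show ?thesis
    using nonempty_family by (auto simp: coset_topology_def topology_generated_by_topspace) blast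
qed

text \<open>The stabilizer is the preimage of a closed point under the continuous map \<open>g \<mapsto> gx\<close>.\<close>

lemma cl_subgroup_stabilizer:
  assumes X: "pro_G_space G \<N> X \<phi>" and x: "x \<in> topspace X"
  shows "cl_subgroup G \<N> (stabilizer G \<phi> x) = stabilizer G \<phi> x"
proof
  have cX: "compact_G_space G X \<phi>"
    and cont: "continuous_map (prod_topology (coset_topology G \<N>) X) X (\<lambda>(g, x). \<phi> g x)"
    using X by (simp_all add: pro_G_space_def)
  interpret group_action G "topspace X" \<phi>
    using cX by (simp add: compact_G_space_def G_space_def)
  have S: "subgroup (stabilizer G \<phi> x) G"
    by (rule stabilizer_subgroup[OF x])
  show "stabilizer G \<phi> x \<subseteq> cl_subgroup G \<N> (stabilizer G \<phi> x)"
    by (rule cl_subgroup_superset[OF S])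
  have orb: "continuous_map (coset_topology G \<N>) X (\<lambda>g. \<phi> g x)"
  proof -
    have "continuous_map (coset_topology G \<N>) (prod_topology (coset_topology G \<N>) X) (\<lambda>g. (g, x))"
      using x by (intro continuous_map_pairedI) auto
    from continuous_map_compose[OF this cont] show ?thesis by (simp add: o_def)
  qed
  show "cl_subgroup G \<N> (stabilizer G \<phi> x) \<subseteq> stabilizer G \<phi> x"
  proof (rule subsetI, rule ccontr)
    fix g assume g: "g \<in> cl_subgroup G \<N> (stabilizer G \<phi> x)" "g \<notin> stabilizer G \<phi> x"
    have gG: "g \<in> carrier G"
      using g(1) subgroup.subset[OF subgroup_cl_subgroup[OF S]] by blast
    define U where "U = {h \<in> topspace (coset_topology G \<N>). \<phi> h x \<in> topspace X - {x}}"
    have "closedin X {x}"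
      using cX x closedin_Hausdorff_singleton by (auto simp: compact_G_space_def)
    then have "openin X (topspace X - {x})" by blast
    then have "openin (coset_topology G \<N>) U"
      unfolding U_def by (rule openin_continuous_map_preimage[OF orb])
    moreover have "g \<in> U"
      using g(2) gG element_image[OF gG x refl] by (simp add: U_def topspace_coset_topology stabilizer_def)
    ultimately obtain N where N: "N \<in> \<N>" "g <# N \<subseteq> U"
      using coset_in_open_coset_topology by blast
    have sN: "subgroup N G"
      by (rule normal_imp_subgroup[OF normal_family[OF N(1)]])
    obtain h n where hn: "h \<in> stabilizer G \<phi> x" "n \<in> N" "g = h \<otimes> n"
      using g(1) N(1) by (auto simp: cl_subgroup_def set_mult_def)
    have "h = g \<otimes> inv n"
      using hn subgroup.mem_carrier[OF S hn(1)] subgroup.mem_carrier[OF sN hn(2)] by (simp add: m_assoc)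
    then have "h \<in> g <# N"
      using subgroup.m_inv_closed[OF sN hn(2)] unfolding l_coset_def by blast
    then have "\<phi> h x \<noteq> x"
      using N(2) by (auto simp: U_def)
    then show False
      using hn(1) by (simp add: stabilizer_def)
  qed
qed

end

section \<open>Subset dynamics of an action with open stabilizers\<close>

text \<open>Elements of \<^const>\<open>BijGroup\<close> are extensional functions, hence the restriction.\<close>

lemma (in group) group_action_restrictI:
  assumes closed: "\<And>g x. g \<in> carrier G \<Longrightarrow> x \<in> E \<Longrightarrow> \<phi> g x \<in> E"
    and one: "\<And>x. x \<in> E \<Longrightarrow> \<phi> \<one> x = x"
    and mult: "\<And>g h x. g \<in> carrier G \<Longrightarrow> h \<in> carrier G \<Longrightarrow> x \<in> E \<Longrightarrow> \<phi> (g \<otimes> h) x = \<phi> g (\<phi> h x)"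
  shows "group_action G E (\<lambda>g. restrict (\<phi> g) E)"
proof -
  have inverse: "\<phi> g (\<phi> (inv g) x) = x" "\<phi> (inv g) (\<phi> g x) = x"
    if "g \<in> carrier G" "x \<in> E" for g x
    using mult[of g "inv g" x] mult[of "inv g" g x] one that by simp_all
  have Bij: "restrict (\<phi> g) E \<in> Bij E" if g: "g \<in> carrier G" for g
  proof -
    have "bij_betw (\<phi> g) E E"
      using closed[OF g] closed[OF inv_closed[OF g]] inverse[OF g]
      by (intro bij_betwI[of _ _ _ "\<phi> (inv g)"]) auto
    then show ?thesis
      by (simp add: Bij_def cong: bij_betw_cong)
  qed
  have "restrict (\<phi> (g \<otimes> h)) E = compose E (restrict (\<phi> g) E) (restrict (\<phi> h) E)"
    if "g \<in> carrier G" "h \<in> carrier G" for g h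
    using mult[OF that] closed[OF that(2)] by (auto simp: compose_def restrict_def)
  then have "(\<lambda>g. restrict (\<phi> g) E) \<in> hom G (BijGroup E)"
    using Bij by (auto simp: hom_def BijGroup_def)
  then show ?thesis
    by (intro group_action.intro group_hom.intro group_hom_axioms.intro is_group group_BijGroup)
qed

text \<open>Every point of the set \<open>C\<close> is fixed by a member of the family, that is, stabilizers are open. Then orbits
are finite, and \<open>G\<close> acts on subsets of \<open>C\<close> by translation.\<close>

locale smooth_action = finite_index_family G \<N> + action: group_action G C \<psi>
  for G (structure) and \<N> and C :: "'c set" and \<psi> +
  assumes fixing: "c \<in> C \<Longrightarrow> \<exists>N\<in>\<N>. \<forall>n\<in>N. \<psi> n c = c"
begin

lemma fixes_orbit:
  assumes N: "N \<in> \<N>" "\<forall>n\<in>N. \<psi> n c = c" and c: "c \<in> C" and g: "g \<in> carrier G" and n: "n \<in> N"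
  shows "\<psi> n (\<psi> g c) = \<psi> g c"
proof -
  interpret N: normal N G
    by (rule normal_family[OF N(1)])
  have nG: "n \<in> carrier G" using n by (rule N.mem_carrier)
  have conj: "inv g \<otimes> n \<otimes> g \<in> N"
    by (rule N.inv_op_closed1[OF g n])
  have "n \<otimes> g = g \<otimes> (inv g \<otimes> n \<otimes> g)"
    using nG g by (simp flip: m_assoc)
  then have "\<psi> n (\<psi> g c) = \<psi> g (\<psi> (inv g \<otimes> n \<otimes> g) c)"
    using action.composition_rule[OF c] g nG by (metis inv_closed m_closed)
  then show ?thesis
    using N(2) conj by simp
qed

lemma finite_orbit:
  assumes c: "c \<in> C"
  shows "finite (orbit G \<psi> c)"
proof -
  obtain N where N: "N \<in> \<N>" "\<forall>n\<in>N. \<psi> n c = c"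
    using fixing[OF c] by blast
  interpret N: normal N G
    by (rule normal_family[OF N(1)])
  have "\<psi> g c = \<psi> (SOME r. r \<in> N #> g) c" if g: "g \<in> carrier G" for g
  proof -
    have "(SOME r. r \<in> N #> g) \<in> N #> g"
      using rcos_self[OF g N.subgroup_axioms] by (rule someI)
    then obtain n where n: "n \<in> N" "(SOME r. r \<in> N #> g) = n \<otimes> g"
      by (auto simp: r_coset_def)
    then show ?thesis
      using action.composition_rule[OF c N.mem_carrier[OF n(1)] g] fixes_orbit[OF N c g n(1)] by simp
  qed
  then have "orbit G \<psi> c \<subseteq> (\<lambda>K. \<psi> (SOME r. r \<in> K) c) ` (rcosets N)"
    using rcosetsI[OF N.subset] unfolding orbit_def by blast
  then show ?thesis
    using finite_index[OF N(1)] finite_surj by blast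
qed

lemma mem_translate:
  assumes g: "g \<in> carrier G" and x: "x \<subseteq> C" and c: "c \<in> C"
  shows "c \<in> \<psi> g ` x \<longleftrightarrow> \<psi> (inv g) c \<in> x"
proof
  assume "c \<in> \<psi> g ` x"
  then show "\<psi> (inv g) c \<in> x"
    using action.orbit_sym_aux[OF g] x by auto
next
  assume "\<psi> (inv g) c \<in> x"
  moreover have "\<psi> g (\<psi> (inv g) c) = c"
    using action.orbit_sym_aux[OF inv_closed[OF g] c refl] g by simp
  ultimately show "c \<in> \<psi> g ` x" by force
qed

lemma translate_subset:
  assumes "g \<in> carrier G" "x \<subseteq> C"
  shows "\<psi> g ` x \<subseteq> C"
  using action.surj_prop[OF assms(1)] assms(2) by blast

lemma translate_mult:
  assumes "g \<in> carrier G" "h \<in> carrier G" "x \<subseteq> C"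
  shows "\<psi> (g \<otimes> h) ` x = \<psi> g ` \<psi> h ` x"
  using action.composition_rule assms by (force simp: image_image subset_iff intro!: image_cong)

lemma translate_one:
  assumes "x \<subseteq> C"
  shows "\<psi> \<one> ` x = x"
  using assms unfolding action.id_eq_one[symmetric] by (auto simp: subset_iff image_iff)

lemma group_action_translate:
  assumes E: "E \<subseteq> Pow C" "\<And>g x. g \<in> carrier G \<Longrightarrow> x \<in> E \<Longrightarrow> \<psi> g ` x \<in> E"
  shows "group_action G E (\<lambda>g. \<lambda>x\<in>E. \<psi> g ` x)"
proof (rule group_action_restrictI)
  fix g h x assume "g \<in> carrier G" "h \<in> carrier G" "x \<in> E"
  then show "\<psi> (g \<otimes> h) ` x = \<psi> g ` \<psi> h ` x"
    using E(1) by (intro translate_mult) blast+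
next
  fix x assume "x \<in> E"
  then show "\<psi> \<one> ` x = x"
    using E(1) by (intro translate_one) blast
qed (rule E(2))

text \<open>Whether \<open>c\<close> belongs to the translate of \<open>x\<close> by \<open>g\<close> depends only on whether \<open>g\<inverse>c\<close> belongs to \<open>x\<close>, and \<open>g\<inverse>c\<close>
depends only on the coset of \<open>g\<close> modulo a normal subgroup \<open>N\<close> that fixes \<open>c\<close>. This gives joint continuity.\<close>

lemma pro_G_space_translate:
  assumes ne: "E \<noteq> {}" and closed: "closedin (powerset_top C) E"
    and inv: "\<And>g x. g \<in> carrier G \<Longrightarrow> x \<in> E \<Longrightarrow> \<psi> g ` x \<in> E"
  shows "pro_G_space G \<N> (subtopology (powerset_top C) E) (\<lambda>g. \<lambda>x\<in>E. \<psi> g ` x)"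
proof -
  let ?X = "subtopology (powerset_top C) E" and ?\<phi> = "\<lambda>g. \<lambda>x\<in>E. \<psi> g ` x"
  have EC: "E \<subseteq> Pow C"
    using closedin_subset[OF closed] by simp
  have top: "topspace ?X = E" using EC by auto
  have open_mem: "openin ?X {x \<in> E. c \<in> x \<longleftrightarrow> b}" if "c \<in> C" for c b
  proof -
    have "{x \<in> E. c \<in> x \<longleftrightarrow> b} = {x \<in> Pow C. c \<in> x \<longleftrightarrow> b} \<inter> E"
      using EC by blast
    then show ?thesis
      unfolding openin_subtopology using clopen_member[OF that, of b] by metis
  qed
  interpret translate: group_action G E ?\<phi>
    by (rule group_action_translate[OF EC inv])
  have open_coset: "openin (coset_topology G \<N>) (g <# N)" if "g \<in> carrier G" "N \<in> \<N>" for g N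
    unfolding coset_topology_def using that by (intro topology_generated_by_Basis) blast
  have action_closed: "(\<lambda>(g, x). ?\<phi> g x) \<in> topspace (prod_topology (coset_topology G \<N>) ?X) \<rightarrow> E"
  proof
    fix p assume "p \<in> topspace (prod_topology (coset_topology G \<N>) ?X)"
    then have p: "fst p \<in> carrier G" "snd p \<in> E"
      using top by (auto simp: topspace_coset_topology)
    then have "(case p of (g, x) \<Rightarrow> ?\<phi> g x) = \<psi> (fst p) ` snd p"
      by (simp add: split_beta)
    then show "(case p of (g, x) \<Rightarrow> ?\<phi> g x) \<in> E"
      using inv[OF p] by (simp only:)
  qed
  have continuous_action: "continuous_map (prod_topology (coset_topology G \<N>) ?X) ?X (\<lambda>(g, x). ?\<phi> g x)"
    unfolding continuous_map_in_subtopology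
  proof
    show "continuous_map (prod_topology (coset_topology G \<N>) ?X) (powerset_top C) (\<lambda>(g, x). ?\<phi> g x)"
    proof (rule continuous_map_powerset_top)
      show "(\<lambda>(g, x). ?\<phi> g x) \<in> topspace (prod_topology (coset_topology G \<N>) ?X) \<rightarrow> Pow C"
        using action_closed EC by (rule subsetD[OF Pi_mono, rotated])
      fix c b assume c: "c \<in> C"
      let ?W = "{p \<in> topspace (prod_topology (coset_topology G \<N>) ?X). c \<in> (\<lambda>(g, x). ?\<phi> g x) p \<longleftrightarrow> b}"
      show "openin (prod_topology (coset_topology G \<N>) ?X) ?W"
      proof (subst openin_subopen, intro ballI)
        fix p assume p: "p \<in> ?W"
        obtain g x where gx: "p = (g, x)" "g \<in> carrier G" "x \<in> E" "c \<in> \<psi> g ` x \<longleftrightarrow> b"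
          using p top by (cases p) (auto simp: topspace_coset_topology)
        obtain N where N: "N \<in> \<N>" "\<forall>n\<in>N. \<psi> n c = c"
          using fixing[OF c] by blast
        interpret N: normal N G
          by (rule normal_family[OF N(1)])
        define c' where "c' = \<psi> (inv g) c"
        have c': "c' \<in> C"
          using action.element_image[OF inv_closed[OF gx(2)] c] by (simp add: c'_def)
        have gN: "\<psi> (inv h) c = c'" if h: "h \<in> g <# N" for h
        proof -
          obtain n where n: "n \<in> N" "h = g \<otimes> n"
            using h by (auto simp: l_coset_def)
          have "\<psi> (inv h) c = \<psi> (inv n) (\<psi> (inv g) c)"
            using n gx(2) N.mem_carrier[OF n(1)] action.composition_rule[OF c]
            by (simp add: inv_mult_group)
          then show ?thesis
            using fixes_orbit[OF N c inv_closed[OF gx(2)] N.m_inv_closed[OF n(1)]]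
            by (simp add: c'_def)
        qed
        have "g \<in> g <# N"
          by (rule mem_l_coset_self[OF gx(2) N.subgroup_axioms])
        then have "p \<in> (g <# N) \<times> {y \<in> E. c' \<in> y \<longleftrightarrow> b}"
          using gx mem_translate[OF gx(2) _ c] EC by (auto simp: c'_def)
        moreover have "(g <# N) \<times> {y \<in> E. c' \<in> y \<longleftrightarrow> b} \<subseteq> ?W"
        proof
          fix q assume "q \<in> (g <# N) \<times> {y \<in> E. c' \<in> y \<longleftrightarrow> b}"
          then obtain h y where q: "q = (h, y)" and h: "h \<in> g <# N" and y: "y \<in> E" "c' \<in> y \<longleftrightarrow> b"
            by blast
          have hG: "h \<in> carrier G"
            using h l_coset_subset_G[OF N.subset gx(2)] by blast
          have "c \<in> \<psi> h ` y \<longleftrightarrow> b"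
            using mem_translate[OF hG _ c] gN[OF h] y EC by auto
          then show "q \<in> ?W"
            using hG y(1) top by (simp add: q topspace_coset_topology)
        qed
        moreover have "openin (prod_topology (coset_topology G \<N>) ?X)
            ((g <# N) \<times> {y \<in> E. c' \<in> y \<longleftrightarrow> b})"
          unfolding openin_prod_Times_iff using open_coset[OF gx(2) N(1)] open_mem[OF c'] by blast
        ultimately show "\<exists>T. openin (prod_topology (coset_topology G \<N>) ?X) T \<and> p \<in> T \<and> T \<subseteq> ?W"
          by blast
      qed
    qed
  qed (rule action_closed)
  have continuous: "continuous_map ?X ?X (?\<phi> g)" if g: "g \<in> carrier G" for g
  proof -
    have "continuous_map ?X (prod_topology (coset_topology G \<N>) ?X) (\<lambda>x. (g, x))"
      using g by (intro continuous_map_pairedI) (auto simp: topspace_coset_topology)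
    from continuous_map_compose[OF this continuous_action] show ?thesis
      unfolding o_def prod.case .
  qed
  have "homeomorphic_map ?X ?X (?\<phi> g)" if g: "g \<in> carrier G" for g
  proof (rule homeomorphic_maps_imp_map)
    show "homeomorphic_maps ?X ?X (?\<phi> g) (?\<phi> (inv g))"
      unfolding homeomorphic_maps_def top
      using continuous[OF g] continuous[OF inv_closed[OF g]]
        translate.orbit_sym_aux[OF g _ refl] translate.orbit_sym_aux[OF inv_closed[OF g] _ refl] g
      by (metis inv_inv)
  qed
  moreover have "compact_space ?X" "Hausdorff_space ?X"
    using closedin_compact_space[OF compact_Hausdorff_powerset_top(1) closed]
    by (auto simp: compact_space_subtopology Hausdorff_space_subtopology compact_Hausdorff_powerset_top)
  ultimately show ?thesis
    using continuous_action translate.group_action_axioms ne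
    unfolding pro_G_space_def compact_G_space_def G_space_def top by blast
qed

text \<open>The orbit of \<open>x\<close> under translation, taken before restricting the action to an invariant set of subsets.\<close>

definition translates :: "'c set \<Rightarrow> 'c set set"
  where "translates x = (\<lambda>g. \<psi> g ` x) ` carrier G"

definition translates_closure :: "'c set \<Rightarrow> 'c set set"
  where "translates_closure x = (powerset_top C) closure_of translates x"

lemma mem_translates_closure:
  assumes "x \<subseteq> C"
  shows "y \<in> translates_closure x \<longleftrightarrow>
    y \<subseteq> C \<and> (\<forall>F. finite F \<longrightarrow> F \<subseteq> C \<longrightarrow> (\<exists>g\<in>carrier G. \<psi> g ` x \<inter> F = y \<inter> F))"
proof -
  have "translates x \<subseteq> Pow C"
    using translate_subset assms by (auto simp: translates_def)
  then show ?thesis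
    unfolding translates_closure_def using in_closure_of_powerset_top[of "translates x" C y]
    by (simp add: translates_def)
qed

lemma translate_closed_translates_closure:
  assumes x: "x \<subseteq> C" and g: "g \<in> carrier G" and y: "y \<in> translates_closure x"
  shows "\<psi> g ` y \<in> translates_closure x"
proof -
  have yC: "y \<subseteq> C"
    using y mem_translates_closure[OF x] by blast
  have *: "\<exists>h\<in>carrier G. \<psi> h ` x \<inter> F = \<psi> g ` y \<inter> F" if F: "finite F" "F \<subseteq> C" for F
  proof -
    define D where "D = \<psi> (inv g) ` F"
    have "finite D" "D \<subseteq> C"
      using F translate_subset[OF inv_closed[OF g] F(2)] by (auto simp: D_def)
    then obtain h where h: "h \<in> carrier G" "\<psi> h ` x \<inter> D = y \<inter> D"
      using y mem_translates_closure[OF x] by meson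
    have "c \<in> \<psi> (g \<otimes> h) ` x \<longleftrightarrow> c \<in> \<psi> g ` y" if c: "c \<in> F" for c
    proof -
      have cC: "c \<in> C" using c F(2) by blast
      have "\<psi> (inv g) c \<in> \<psi> h ` x \<longleftrightarrow> \<psi> (inv g) c \<in> y"
        using h(2) c unfolding D_def by blast
      then show ?thesis
        unfolding translate_mult[OF g h(1) x] mem_translate[OF g yC cC]
          mem_translate[OF g translate_subset[OF h(1) x] cC] .
    qed
    then have "\<psi> (g \<otimes> h) ` x \<inter> F = \<psi> g ` y \<inter> F" by blast
    then show ?thesis
      using m_closed[OF g h(1)] by (rule bexI)
  qed
  show ?thesis
    unfolding mem_translates_closure[OF x]
    by (intro conjI allI impI translate_subset[OF g yC] *)
qed

text \<open>The action on subsets is equicontinuous because orbits in \<open>C\<close> are finite: if \<open>y\<close> agrees with \<open>k x\<close> on the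
union \<open>D\<close> of the orbits that meet \<open>F\<close>, then \<open>h y\<close> agrees with \<open>h k x\<close> on \<open>F\<close> for every \<open>h\<close>. So a translate of
\<open>x\<close> is approximated by translates of any limit \<open>y\<close> of translates of \<open>x\<close>.\<close>

lemma translates_closure_minimal:
  assumes x: "x \<subseteq> C" and y: "y \<in> translates_closure x"
  shows "translates_closure x \<subseteq> translates_closure y"
proof
  fix z assume z: "z \<in> translates_closure x"
  have yC: "y \<subseteq> C" and zC: "z \<subseteq> C"
    using y z mem_translates_closure[OF x] by blast+
  have *: "\<exists>h\<in>carrier G. \<psi> h ` y \<inter> F = z \<inter> F" if F: "finite F" "F \<subseteq> C" for F
  proof -
    obtain g where g: "g \<in> carrier G" "\<psi> g ` x \<inter> F = z \<inter> F"
      using z F mem_translates_closure[OF x] by meson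
    define D where "D = (\<Union>c\<in>F. orbit G \<psi> c)"
    have "finite D" "D \<subseteq> C"
      using F finite_orbit action.element_image by (auto simp: D_def orbit_def)
    then obtain k where k: "k \<in> carrier G" "\<psi> k ` x \<inter> D = y \<inter> D"
      using y mem_translates_closure[OF x] by meson
    define h where "h = g \<otimes> inv k"
    have h: "h \<in> carrier G" "h \<otimes> k = g"
      using g(1) k(1) by (auto simp: h_def m_assoc)
    have "c \<in> \<psi> h ` y \<longleftrightarrow> c \<in> \<psi> g ` x" if c: "c \<in> F" for c
    proof -
      have cC: "c \<in> C" using c F(2) by blast
      have "\<psi> (inv h) c \<in> D"
        using c h(1) by (auto simp: D_def orbit_def)
      then have "\<psi> (inv h) c \<in> y \<longleftrightarrow> \<psi> (inv h) c \<in> \<psi> k ` x"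
        using k(2) by blast
      then have "c \<in> \<psi> h ` y \<longleftrightarrow> c \<in> \<psi> h ` \<psi> k ` x"
        unfolding mem_translate[OF h(1) yC cC] mem_translate[OF h(1) translate_subset[OF k(1) x] cC] .
      then show ?thesis
        unfolding translate_mult[OF h(1) k(1) x, symmetric] h(2) .
    qed
    then have "\<psi> h ` y \<inter> F = \<psi> g ` x \<inter> F" by blast
    then show ?thesis
      using g(2) h(1) by (intro bexI[of _ h]) (simp_all only:)
  qed
  show "z \<in> translates_closure y"
    unfolding mem_translates_closure[OF yC] by (intro conjI allI impI zC *)
qed

theorem translates_closure_pro_minimal:
  assumes x: "x \<subseteq> C"
  defines "E \<equiv> translates_closure x"
  shows "pro_G_space G \<N> (subtopology (powerset_top C) E) (\<lambda>g. \<lambda>x\<in>E. \<psi> g ` x)"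
    and "minimal_G_space G (subtopology (powerset_top C) E) (\<lambda>g. \<lambda>x\<in>E. \<psi> g ` x)"
    and "x \<in> E"
proof -
  let ?X = "subtopology (powerset_top C) E" and ?\<phi> = "\<lambda>g. \<lambda>x\<in>E. \<psi> g ` x"
  show xE: "x \<in> E"
    unfolding E_def mem_translates_closure[OF x] using x translate_one[OF x] one_closed by metis
  have inv: "\<psi> g ` y \<in> E" if "g \<in> carrier G" "y \<in> E" for g y
    using translate_closed_translates_closure[OF x] that by (simp add: E_def)
  have closed: "closedin (powerset_top C) E"
    by (simp add: E_def translates_closure_def)
  show pro: "pro_G_space G \<N> ?X ?\<phi>"
    using xE by (intro pro_G_space_translate closed inv) auto
  have EC: "E \<subseteq> Pow C"
    using closedin_subset[OF closed] by simp
  have "?X closure_of orbit G ?\<phi> y = E" if y: "y \<in> E" for y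
  proof -
    have "orbit G ?\<phi> y = translates y" "translates y \<subseteq> E"
      using y inv by (auto simp: orbit_def translates_def)
    then have "?X closure_of orbit G ?\<phi> y = E \<inter> translates_closure y"
      by (simp add: closure_of_subtopology translates_closure_def Int_absorb1)
    then show ?thesis
      using translates_closure_minimal[OF x] y by (auto simp: E_def)
  qed
  then show "minimal_G_space G ?X ?\<phi>"
    using pro EC
    by (auto simp: minimal_G_space_def orbits_dense_def pro_G_space_def compact_G_space_def Int_absorb1)
qed

end

section \<open>A closed subgroup as a point stabilizer\<close>

context finite_index_family
begin

text \<open>The points of all the finite \<open>G\<close>-sets \<open>G/HN\<close>. A coset determines the subgroup of which it is a left coset,
so a set of these points can encode a compatible family of cosets, i.e. a point of the inverse limit of
the \<open>G/HN\<close>.\<close>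

definition closure_cosets :: "'a set \<Rightarrow> 'a set set"
  where "closure_cosets H = {g <# (H <#> N) | g N. g \<in> carrier G \<and> N \<in> \<N>}"

lemma smooth_action_closure_cosets:
  assumes H: "subgroup H G"
  shows "smooth_action G \<N> (closure_cosets H) (\<lambda>g. \<lambda>c\<in>closure_cosets H. g <# c)"
proof -
  have sub: "subgroup (H <#> N) G" if "N \<in> \<N>" for N
    by (rule subgroup_set_mult_normal[OF H normal_family[OF that]])
  note assoc = lcos_m_assoc[OF subgroup.subset[OF sub]]
  have carr: "c \<subseteq> carrier G" if c: "c \<in> closure_cosets H" for c
  proof -
    from c obtain k N where "c = k <# (H <#> N)" "k \<in> carrier G" "N \<in> \<N>"
      unfolding closure_cosets_def by blast
    then show ?thesis
      using l_coset_subset_G[OF subgroup.subset[OF sub]] by simp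
  qed
  have "group_action G (closure_cosets H) (\<lambda>g. restrict (\<lambda>c. g <# c) (closure_cosets H))"
  proof (rule group_action_restrictI)
    fix g c assume g: "g \<in> carrier G" and c: "c \<in> closure_cosets H"
    obtain k N where k: "c = k <# (H <#> N)" "k \<in> carrier G" "N \<in> \<N>"
      using c unfolding closure_cosets_def by blast
    show "g <# c \<in> closure_cosets H"
      unfolding k(1) assoc[OF k(3) g k(2)] closure_cosets_def using g k(2,3) by blast
  next
    fix c assume c: "c \<in> closure_cosets H"
    show "\<one> <# c = c"
      by (rule lcos_mult_one[OF carr[OF c]])
  next
    fix g h c assume "g \<in> carrier G" "h \<in> carrier G" "c \<in> closure_cosets H"
    then show "g \<otimes> h <# c = g <# (h <# c)"
      using lcos_m_assoc[OF carr] by simp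
  qed
  then show ?thesis
  proof (intro smooth_action.intro smooth_action_axioms.intro finite_index_family_axioms)
    fix c assume c: "c \<in> closure_cosets H"
    obtain g N where g: "c = g <# (H <#> N)" "g \<in> carrier G" and N: "N \<in> \<N>"
      using c unfolding closure_cosets_def by blast
    interpret N: normal N G
      by (rule normal_family[OF N])
    have "n <# c = c" if n: "n \<in> N" for n
    proof -
      have nG: "n \<in> carrier G" by (rule N.mem_carrier[OF n])
      have m: "inv g \<otimes> n \<otimes> g \<in> N"
        by (rule N.inv_op_closed1[OF g(2) n])
      have mG: "inv g \<otimes> n \<otimes> g \<in> carrier G" by (rule N.mem_carrier[OF m])
      have "\<one> \<otimes> (inv g \<otimes> n \<otimes> g) \<in> H <#> N"
        using subgroup.one_closed[OF H] m unfolding set_mult_def by blast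
      then have mHN: "inv g \<otimes> n \<otimes> g \<in> H <#> N"
        using mG by simp
      have "n \<otimes> g = g \<otimes> (inv g \<otimes> n \<otimes> g)"
        using nG g(2) by (simp flip: m_assoc)
      then have "n <# c = g <# ((inv g \<otimes> n \<otimes> g) <# (H <#> N))"
        unfolding g(1) using assoc[OF N nG g(2)] assoc[OF N g(2) mG] by simp
      then show ?thesis
        unfolding coset_join3[OF mG sub[OF N] mHN] g(1) .
    qed
    then show "\<exists>N\<in>\<N>. \<forall>n\<in>N. (\<lambda>c\<in>closure_cosets H. n <# c) c = c"
      using N c by auto
  qed
qed

text \<open>The space is the inverse limit of the \<open>G/HN\<close>, realized as the orbit closure of the base point
\<open>{HN | N}\<close> among the subsets of the union of the \<open>G/HN\<close>. An element that fixes the base point maps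
\<open>HN\<close> to some \<open>HN'\<close>, a coset that contains \<open>1\<close>, and so it lies in \<open>HN\<close>. The stabilizer of the base point is
therefore the closure of \<open>H\<close>, which is \<open>H\<close>.\<close>

theorem closed_subgroup_is_stabilizer:
  assumes H: "subgroup H G" and closed: "cl_subgroup G \<N> H = H"
  obtains X :: "'a set set topology" and \<phi> x
  where "pro_G_space G \<N> X \<phi>" "minimal_G_space G X \<phi>" "x \<in> topspace X" "stabilizer G \<phi> x = H"
proof -
  let ?C = "closure_cosets H" and ?\<psi> = "\<lambda>g. \<lambda>c\<in>closure_cosets H. g <# c"
  interpret smooth_action G \<N> ?C ?\<psi>
    by (rule smooth_action_closure_cosets[OF H])
  define x where "x = (\<lambda>N. H <#> N) ` \<N>"
  have sub: "subgroup (H <#> N) G" if "N \<in> \<N>" for N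
    by (rule subgroup_set_mult_normal[OF H normal_family[OF that]])
  have xC: "x \<subseteq> ?C"
  proof
    fix c assume "c \<in> x"
    then obtain N where N: "N \<in> \<N>" "c = H <#> N" by (auto simp: x_def)
    then have "c = \<one> <# (H <#> N)"
      using lcos_mult_one[OF subgroup.subset[OF sub]] by simp
    then show "c \<in> ?C"
      unfolding closure_cosets_def using N(1) by blast
  qed
  define E where "E = translates_closure x"
  define \<phi> where "\<phi> = (\<lambda>g. \<lambda>y\<in>E. ?\<psi> g ` y)"
  note E = translates_closure_pro_minimal[OF xC, folded E_def, folded \<phi>_def]
  have top: "topspace (subtopology (powerset_top ?C) E) = E"
    by (auto simp: E_def mem_translates_closure[OF xC])
  have translate_x: "\<phi> g x = (\<lambda>c. g <# c) ` x" for g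
    using E(3) xC by (auto simp: \<phi>_def subset_iff intro!: image_cong)
  have "g \<in> H" if g: "g \<in> carrier G" "\<phi> g x = x" for g
  proof -
    have "g \<in> H <#> N" if N: "N \<in> \<N>" for N
    proof -
      have "g <# (H <#> N) \<in> x"
        using g(2) N unfolding translate_x by (auto simp: x_def)
      then obtain N' where "N' \<in> \<N>" "g <# (H <#> N) = H <#> N'"
        by (auto simp: x_def)
      then have "\<one> \<in> g <# (H <#> N)"
        using subgroup.one_closed[OF sub] by simp
      then obtain k where k: "k \<in> H <#> N" "\<one> = g \<otimes> k"
        by (auto simp: l_coset_def)
      then have "g = inv k"
        using g(1) subgroup.mem_carrier[OF sub[OF N] k(1)] by (simp add: inv_equality)
      then show ?thesis
        using subgroup.m_inv_closed[OF sub[OF N] k(1)] by simp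
    qed
    then have "g \<in> cl_subgroup G \<N> H" by (simp add: cl_subgroup_def)
    then show ?thesis using closed by simp
  qed
  moreover have "\<phi> g x = x" if g: "g \<in> H" for g
  proof -
    have "g <# (H <#> N) = H <#> N" if N: "N \<in> \<N>" for N
    proof (rule coset_join3[OF subgroup.mem_carrier[OF H g] sub[OF N]])
      show "g \<in> H <#> N"
        using g closed N by (auto simp: cl_subgroup_def)
    qed
    then show ?thesis
      unfolding translate_x by (simp add: x_def image_image)
  qed
  ultimately have "stabilizer G \<phi> x = H"
    using subgroup.mem_carrier[OF H] by (auto simp: stabilizer_def)
  then show thesis
    using E top by (intro that[of "subtopology (powerset_top ?C) E" \<phi> x]) auto
qed

section \<open>The two constructions of a URS\<close>

text \<open>Some point stabilizer belongs to \<open>\<H>\<close>. It is closed, hence a value on \<open>\<H>\<close> of the closure map, and one value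
in \<open>\<H>\<close> identifies the URS of the closure map as \<open>\<H>\<close>.\<close>

theorem cl_URS_stabilizer_URS:
  fixes X :: "'x topology"
  assumes G: "countable (carrier G)" and \<H>: "is_URS G \<H>"
    and X: "pro_G_space G \<N> X \<phi>" "minimal_G_space G X \<phi>" and S: "stabilizer_URS G X \<phi> = \<H>"
  shows "cl_URS G \<N> \<H> = \<H>"
proof -
  have ci: "closed_invariant \<H>"
    using \<H> unfolding is_URS_iff_orbit_closure by blast
  have top: "topspace (subtopology (Sub_top G) \<H>) = \<H>"
    using subgroup_closed_invariant[OF ci] by auto
  interpret stab: semicontinuous_subgroup_map G X \<phi> "stabilizer G \<phi>"
    using X by (intro stabilizer_semicontinuous_subgroup_map is_group G) (simp_all add: pro_G_space_def)
  interpret cl: semicontinuous_subgroup_map G "subtopology (Sub_top G) \<H>" "conj_act G" "cl_subgroup G \<N>"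
    by (rule cl_subgroup_semicontinuous_subgroup_map[OF G \<H>])
  have "stab.image_URS = \<H>"
    using S unfolding stab.image_URS_def stabilizer_URS_def .
  then obtain x where x: "x \<in> topspace X" "stabilizer G \<phi> x \<in> \<H>"
    using stab.ex_value_in_image_URS by blast
  have "cl.image_URS = \<H>"
    using x(2) cl_subgroup_stabilizer[OF X(1) x(1)]
    by (intro cl.image_URS_eq[OF \<H>, of "stabilizer G \<phi> x"]) (simp_all only: top)
  then show ?thesis
    unfolding cl.image_URS_def cl_URS_def top .
qed

text \<open>Dually, some closure belongs to \<open>\<H>\<close>. Being a closed subgroup it is a point stabilizer of a minimal
pro-\<open>\<N>\<close> space, and one stabilizer in \<open>\<H>\<close> identifies the stabilizer URS as \<open>\<H>\<close>.\<close>

theorem closed_URS_is_stabilizer_URS: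
  assumes G: "countable (carrier G)" and \<H>: "is_URS G \<H>" and cl: "cl_URS G \<N> \<H> = \<H>"
  obtains X :: "'a set set topology" and \<phi>
  where "pro_G_space G \<N> X \<phi>" "minimal_G_space G X \<phi>" "stabilizer_URS G X \<phi> = \<H>"
proof -
  have ci: "closed_invariant \<H>"
    using \<H> unfolding is_URS_iff_orbit_closure by blast
  note sub = subgroup_closed_invariant[OF ci]
  have top: "topspace (subtopology (Sub_top G) \<H>) = \<H>"
    using sub by auto
  interpret cl: semicontinuous_subgroup_map G "subtopology (Sub_top G) \<H>" "conj_act G" "cl_subgroup G \<N>"
    by (rule cl_subgroup_semicontinuous_subgroup_map[OF G \<H>])
  have "cl.image_URS = \<H>"
    using cl unfolding cl.image_URS_def cl_URS_def top .
  then obtain K where K: "K \<in> \<H>" "cl_subgroup G \<N> K \<in> \<H>"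
    using cl.ex_value_in_image_URS top by blast
  obtain X :: "'a set set topology" and \<phi> x
    where X: "pro_G_space G \<N> X \<phi>" "minimal_G_space G X \<phi>"
      and x: "x \<in> topspace X" "stabilizer G \<phi> x = cl_subgroup G \<N> K"
    using closed_subgroup_is_stabilizer[OF subgroup_cl_subgroup[OF sub[OF K(1)]]
        cl_subgroup_idem[OF sub[OF K(1)]]] by blast
  interpret stab: semicontinuous_subgroup_map G X \<phi> "stabilizer G \<phi>"
    using X by (intro stabilizer_semicontinuous_subgroup_map is_group G) (simp_all add: pro_G_space_def)
  have "stab.image_URS = \<H>"
    using x K(2) by (intro stab.image_URS_eq[OF \<H> x(1)]) simp
  then show thesis
    using X by (intro that[of X \<phi>]) (simp_all add: stab.image_URS_def stabilizer_URS_def)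
qed

end

(* HOL cannot quantify existentially over types. A minimal G-space has a dense subset of size at
   most |G|, so a compact one has at most as many points as the type 'g set set, and the
   existential loses nothing by taking X there. The second conjunct states the implication from
   (2) to (1) for spaces X over an arbitrary type 'x. *)
theorem proposition2:
  fixes G :: "('g, 'm) monoid_scheme" and \<N> \<H> :: "'g set set"
  assumes "group G" and "countable (carrier G)"
    and "\<N> \<noteq> {}" and "filtering \<N>"
    and "\<And>N. N \<in> \<N> \<Longrightarrow> N \<lhd> G \<and> finite (rcosets\<^bsub>G\<^esub> N)"
    and "is_URS G \<H>"
  shows "(cl_URS G \<N> \<H> = \<H> \<longleftrightarrow>
           (\<exists>(X :: 'g set set topology) \<phi>.
              pro_G_space G \<N> X \<phi> \<and> minimal_G_space G X \<phi> \<and> stabilizer_URS G X \<phi> = \<H>)) \<and>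
         ((\<exists>(X :: 'x topology) \<phi>.
              pro_G_space G \<N> X \<phi> \<and> minimal_G_space G X \<phi> \<and> stabilizer_URS G X \<phi> = \<H>)
           \<longrightarrow> cl_URS G \<N> \<H> = \<H>)"
proof -
  interpret finite_index_family G \<N>
    using assms(1,3,4,5) by (intro finite_index_family.intro finite_index_family_axioms.intro) auto
  show ?thesis
  proof (intro conjI iffI impI)
    assume "cl_URS G \<N> \<H> = \<H>"
    then show "\<exists>(X :: 'g set set topology) \<phi>.
        pro_G_space G \<N> X \<phi> \<and> minimal_G_space G X \<phi> \<and> stabilizer_URS G X \<phi> = \<H>"
      using closed_URS_is_stabilizer_URS[OF assms(2,6)] by metis
  qed (elim exE conjE, rule cl_URS_stabilizer_URS[OF assms(2,6)], assumption+)+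
qed

end
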